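(* Let $n\geq 3$ and $m\geq 2$. Let $(M^{n},g)$ be a noncompact Riemannian manifold with constant scalar curvature $R$, let $(N^{m},\tilde g)$ be a semi-Riemannian manifold, and let $f:M\to(0,+\infty)$ be a smooth function. Suppose that the warped product $(\widehat M^{n+m},\hat g)=(M^{n},g)\times_f(N^{m},\tilde g)$ is Einstein with $\widehat{Ric}=\lambda\hat g$, where $\lambda=\frac{R}{n-1}$. Then $M$ is Ricci-flat if and only if $R=0$.
   Context: The warped product $(M^{n},g)\times_f(N^{m},\tilde g)$ is the product manifold $M\times N$ endowed with the metric $\hat g=g+f^{2}\tilde g$; $M$ is the base, $N$ the fiber and $f$ the warping function. $\widehat{Ric}$ is the Ricci tensor of $\hat g$. *)

theory Defs
  imports "HOL-Analysis.Analysis"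
begin

section \<open>Smooth maps between normed spaces\<close>

text \<open>To be used for open sets \<open>S\<close> only: the derivatives are full two-sided derivatives.\<close>

primrec Ck_on :: "nat \<Rightarrow> 'a::real_normed_vector set \<Rightarrow> ('a \<Rightarrow> 'b::real_normed_vector) \<Rightarrow> bool" where
  "Ck_on 0 S F \<longleftrightarrow> continuous_on S F"
| "Ck_on (Suc k) S F \<longleftrightarrow> (\<forall>x\<in>S. F differentiable (at x)) \<and>
     (\<forall>v. Ck_on k S (\<lambda>x. frechet_derivative F (at x) v))"

definition smooth_on :: "'a::real_normed_vector set \<Rightarrow> ('a \<Rightarrow> 'b::real_normed_vector) \<Rightarrow> bool" where
  "smooth_on S F \<longleftrightarrow> (\<forall>k. Ck_on k S F)"

section \<open>Smooth manifolds\<close>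

text \<open>A manifold of dimension \<open>CARD('n)\<close> is a topological space with an indexed atlas: the chart
  \<open>a \<in> charts M\<close> is the map \<open>cmap M a\<close>, of which only the values on \<open>cdom M a\<close> matter.
  Manifolds need not be connected.\<close>

record ('p, 'i, 'n) manifold =
  pts :: "'p topology"
  charts :: "'i set"
  cdom :: "'i \<Rightarrow> 'p set"
  cmap :: "'i \<Rightarrow> 'p \<Rightarrow> real ^ 'n"

definition cimg :: "('p, 'i, 'n::finite) manifold \<Rightarrow> 'i \<Rightarrow> (real ^ 'n) set" where
  "cimg M a = cmap M a ` cdom M a"

definition param :: "('p, 'i, 'n::finite) manifold \<Rightarrow> 'i \<Rightarrow> real ^ 'n \<Rightarrow> 'p" where
  "param M a = inv_into (cdom M a) (cmap M a)"

definition overlap :: "('p, 'i, 'n::finite) manifold \<Rightarrow> 'i \<Rightarrow> 'i \<Rightarrow> (real ^ 'n) set" where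
  "overlap M a b = cmap M a ` (cdom M a \<inter> cdom M b)"

definition transition :: "('p, 'i, 'n::finite) manifold \<Rightarrow> 'i \<Rightarrow> 'i \<Rightarrow> real ^ 'n \<Rightarrow> real ^ 'n" where
  "transition M a b = cmap M b \<circ> param M a"

definition smooth_manifold :: "('p, 'i, 'n::finite) manifold \<Rightarrow> bool" where
  "smooth_manifold M \<longleftrightarrow>
     Hausdorff_space (pts M) \<and> second_countable (pts M) \<and> topspace (pts M) \<noteq> {} \<and>
     topspace (pts M) = (\<Union>a\<in>charts M. cdom M a) \<and>
     (\<forall>a\<in>charts M. openin (pts M) (cdom M a) \<and> open (cimg M a) \<and>
        homeomorphic_map (subtopology (pts M) (cdom M a)) (top_of_set (cimg M a)) (cmap M a)) \<and>
     (\<forall>a\<in>charts M. \<forall>b\<in>charts M. smooth_on (overlap M a b) (transition M a b))"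

definition smooth_function :: "('p, 'i, 'n::finite) manifold \<Rightarrow> ('p \<Rightarrow> real) \<Rightarrow> bool" where
  "smooth_function M f \<longleftrightarrow> (\<forall>a\<in>charts M. smooth_on (cimg M a) (f \<circ> param M a))"

section \<open>Metric tensors\<close>

text \<open>A symmetric covariant 2-tensor field is given by its component matrices: \<open>g a x\<close> is the matrix
  of the tensor at the point \<open>param M a x\<close> with respect to the coordinate basis of the chart \<open>a\<close>.
  The last condition is the transformation law under a change of charts.\<close>

definition smooth_symmetric_2_tensor ::
    "('p, 'i, 'n::finite) manifold \<Rightarrow> ('i \<Rightarrow> real ^ 'n \<Rightarrow> real ^ 'n ^ 'n) \<Rightarrow> bool" where
  "smooth_symmetric_2_tensor M g \<longleftrightarrow>
     (\<forall>a\<in>charts M. smooth_on (cimg M a) (g a) \<and> (\<forall>x\<in>cimg M a. transpose (g a x) = g a x)) \<and>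
     (\<forall>a\<in>charts M. \<forall>b\<in>charts M. \<forall>x\<in>overlap M a b.
        g a x = transpose (jacobian (transition M a b) (at x)) **
                  g b (transition M a b x) ** jacobian (transition M a b) (at x))"

text \<open>The index of a symmetric bilinear form: the largest dimension of a subspace on which it is
  negative definite.\<close>

definition form_index :: "real ^ 'n ^ 'n::finite \<Rightarrow> nat" where
  "form_index A = Max {dim W |W. subspace W \<and> (\<forall>w\<in>W - {0}. w \<bullet> (A *v w) < 0)}"

definition semi_riemannian_metric ::
    "('p, 'i, 'n::finite) manifold \<Rightarrow> ('i \<Rightarrow> real ^ 'n \<Rightarrow> real ^ 'n ^ 'n) \<Rightarrow> bool" where
  "semi_riemannian_metric M g \<longleftrightarrow> smooth_symmetric_2_tensor M g \<and>
     (\<forall>a\<in>charts M. \<forall>x\<in>cimg M a. invertible (g a x)) \<and>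
     (\<exists>\<nu>. \<forall>a\<in>charts M. \<forall>x\<in>cimg M a. form_index (g a x) = \<nu>)"

definition riemannian_metric ::
    "('p, 'i, 'n::finite) manifold \<Rightarrow> ('i \<Rightarrow> real ^ 'n \<Rightarrow> real ^ 'n ^ 'n) \<Rightarrow> bool" where
  "riemannian_metric M g \<longleftrightarrow> smooth_symmetric_2_tensor M g \<and>
     (\<forall>a\<in>charts M. \<forall>x\<in>cimg M a. \<forall>v. v \<noteq> 0 \<longrightarrow> 0 < v \<bullet> (g a x *v v))"

section \<open>Curvature\<close>

definition partial :: "'n \<Rightarrow> (real ^ 'n \<Rightarrow> real) \<Rightarrow> real ^ 'n::finite \<Rightarrow> real" where
  "partial k F x = frechet_derivative F (at x) (axis k 1)"

text \<open>In a coordinate system in which the metric has component matrix \<open>G\<close>, the Levi-Civita connection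
  is \<open>\<nabla>\<^sub>i \<partial>\<^sub>j = (\<Sum>k. christoffel G k i j *\<^sub>R \<partial>\<^sub>k)\<close>.\<close>

definition christoffel ::
    "(real ^ 'n \<Rightarrow> real ^ 'n ^ 'n) \<Rightarrow> 'n \<Rightarrow> 'n \<Rightarrow> 'n \<Rightarrow> real ^ 'n::finite \<Rightarrow> real" where
  "christoffel G k i j x =
     (\<Sum>l\<in>UNIV. matrix_inv (G x) $ k $ l *
        (partial i (\<lambda>y. G y $ j $ l) x + partial j (\<lambda>y. G y $ i $ l) x
          - partial l (\<lambda>y. G y $ i $ j) x)) / 2"

text \<open>\<open>riemann G l k i j\<close> is the coefficient of \<open>\<partial>\<^sub>l\<close> in
  \<open>R(\<partial>\<^sub>i, \<partial>\<^sub>j) \<partial>\<^sub>k = \<nabla>\<^sub>i \<nabla>\<^sub>j \<partial>\<^sub>k - \<nabla>\<^sub>j \<nabla>\<^sub>i \<partial>\<^sub>k\<close>, and \<open>Ric(Y, Z)\<close> is the trace of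
  \<open>X \<mapsto> R(X, Y) Z\<close>; round spheres have positive Ricci curvature.\<close>

definition riemann ::
    "(real ^ 'n \<Rightarrow> real ^ 'n ^ 'n) \<Rightarrow> 'n \<Rightarrow> 'n \<Rightarrow> 'n \<Rightarrow> 'n \<Rightarrow> real ^ 'n::finite \<Rightarrow> real" where
  "riemann G l k i j x =
     partial i (christoffel G l j k) x - partial j (christoffel G l i k) x
     + (\<Sum>p\<in>UNIV. christoffel G l i p x * christoffel G p j k x
                  - christoffel G l j p x * christoffel G p i k x)"

definition ricci ::
    "(real ^ 'n \<Rightarrow> real ^ 'n ^ 'n) \<Rightarrow> real ^ 'n::finite \<Rightarrow> real ^ 'n ^ 'n" where
  "ricci G x = (\<chi> j k. \<Sum>i\<in>UNIV. riemann G i k i j x)"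

definition scalar :: "(real ^ 'n \<Rightarrow> real ^ 'n ^ 'n) \<Rightarrow> real ^ 'n::finite \<Rightarrow> real" where
  "scalar G x = (\<Sum>j\<in>UNIV. \<Sum>k\<in>UNIV. matrix_inv (G x) $ j $ k * ricci G x $ j $ k)"

definition constant_scalar_curvature ::
    "('p, 'i, 'n::finite) manifold \<Rightarrow> ('i \<Rightarrow> real ^ 'n \<Rightarrow> real ^ 'n ^ 'n) \<Rightarrow> real \<Rightarrow> bool" where
  "constant_scalar_curvature M g R \<longleftrightarrow> (\<forall>a\<in>charts M. \<forall>x\<in>cimg M a. scalar (g a) x = R)"

definition einstein ::
    "('p, 'i, 'n::finite) manifold \<Rightarrow> ('i \<Rightarrow> real ^ 'n \<Rightarrow> real ^ 'n ^ 'n) \<Rightarrow> real \<Rightarrow> bool" where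
  "einstein M g lam \<longleftrightarrow> (\<forall>a\<in>charts M. \<forall>x\<in>cimg M a. ricci (g a) x = lam *\<^sub>R g a x)"

definition ricci_flat ::
    "('p, 'i, 'n::finite) manifold \<Rightarrow> ('i \<Rightarrow> real ^ 'n \<Rightarrow> real ^ 'n ^ 'n) \<Rightarrow> bool" where
  "ricci_flat M g \<longleftrightarrow> (\<forall>a\<in>charts M. \<forall>x\<in>cimg M a. ricci (g a) x = 0)"

section \<open>Products and warped products\<close>

definition vpair :: "real ^ 'n \<Rightarrow> real ^ 'm \<Rightarrow> real ^ ('n::finite + 'm::finite)" where
  "vpair x y = (\<chi> i. case i of Inl k \<Rightarrow> x $ k | Inr l \<Rightarrow> y $ l)"

definition vfst :: "real ^ ('n::finite + 'm::finite) \<Rightarrow> real ^ 'n" where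
  "vfst z = (\<chi> k. z $ Inl k)"

definition vsnd :: "real ^ ('n::finite + 'm::finite) \<Rightarrow> real ^ 'm" where
  "vsnd z = (\<chi> l. z $ Inr l)"

definition product_manifold ::
    "('p, 'i, 'n::finite) manifold \<Rightarrow> ('q, 'j, 'm::finite) manifold
      \<Rightarrow> ('p \<times> 'q, 'i \<times> 'j, 'n + 'm) manifold" where
  "product_manifold M N =
     \<lparr> pts = prod_topology (pts M) (pts N),
       charts = charts M \<times> charts N,
       cdom = (\<lambda>(a, b). cdom M a \<times> cdom N b),
       cmap = (\<lambda>(a, b) (p, q). vpair (cmap M a p) (cmap N b q)) \<rparr>"

text \<open>The metric \<open>g + f\<^sup>2 h\<close> on the product manifold, in product charts.\<close>

definition warped_metric ::
    "('p, 'i, 'n::finite) manifold \<Rightarrow> ('i \<Rightarrow> real ^ 'n \<Rightarrow> real ^ 'n ^ 'n) \<Rightarrow> ('p \<Rightarrow> real)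
      \<Rightarrow> ('j \<Rightarrow> real ^ 'm \<Rightarrow> real ^ 'm ^ 'm)
      \<Rightarrow> 'i \<times> 'j \<Rightarrow> real ^ ('n + 'm::finite) \<Rightarrow> real ^ ('n + 'm) ^ ('n + 'm)" where
  "warped_metric M g f h = (\<lambda>(a, b) z. \<chi> s t. case (s, t) of
       (Inl i, Inl j) \<Rightarrow> g a (vfst z) $ i $ j
     | (Inr i, Inr j) \<Rightarrow> (f (param M a (vfst z)))\<^sup>2 * h b (vsnd z) $ i $ j
     | _ \<Rightarrow> 0)"

end

theory Submission
  imports Defs
begin

text \<open>
  If \<open>M\<close> is Ricci-flat, then \<open>R\<close>, being a trace of the Ricci tensor, is zero. The content is the
  converse: \<open>R = 0\<close> gives \<open>\<lambda> = 0\<close>, so the warped product is Ricci-flat, and this has to be brought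
  down to the base. Everything happens in one product chart.

  Let \<open>V = \<nabla>f\<close> and \<open>T = \<nabla>V\<close>, the Hessian of \<open>f\<close> with one index raised. With \<open>m\<close> the dimension of
  the fiber, the Ricci tensor of \<open>g + f\<^sup>2 h\<close> is \<open>Ric\<^sub>g - (m/f) Hess f\<close> in the directions of the base
  and \<open>Ric\<^sub>h - (f \<Delta>f + (m - 1) \<bar>\<nabla>f\<bar>\<^sup>2) h\<close> in those of the fiber (\<open>ricci_warped_base\<close>,
  \<open>ricci_warped_fiber\<close>). Hence:

  \<^item> \<open>Ric\<^sub>g = (m/f) Hess f\<close>, and taking the trace with \<open>R = 0\<close> shows that \<open>f\<close> is harmonic;

  \<^item> \<open>(m - 1) \<bar>\<nabla>f\<bar>\<^sup>2 h = Ric\<^sub>h\<close>, where the right-hand side does not depend on the point of the base, so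
    \<open>\<bar>\<nabla>f\<bar>\<close> is constant on the chart. Differentiating, \<open>Hess f (V, \<cdot>) = 0\<close>.

  Now the Bochner argument applies. Contracting the Ricci identity \<open>\<nabla>\<^sub>k \<nabla>\<^sub>j V\<^sup>k - \<nabla>\<^sub>j \<nabla>\<^sub>k V\<^sup>k = Ric\<^sub>j\<^sub>l V\<^sup>l\<close>
  (\<open>ricci_identity\<close>) with \<open>V\<^sup>j\<close> and using \<open>T V = 0\<close> and \<open>tr T = 0\<close> gives \<open>tr (T\<^sup>2) = - Ric\<^sub>g (V, V)\<close>
  (\<open>bochner_constant_length\<close>). The right-hand side is \<open>- (m/f) Hess f (V, V) = 0\<close>. Since \<open>T\<close> is
  self-adjoint for the positive definite \<open>g\<close>, \<open>tr (T\<^sup>2) = \<bar>Hess f\<bar>\<^sup>2\<close>; so \<open>Hess f = 0\<close>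
  (\<open>hessian_zero\<close>) and therefore \<open>Ric\<^sub>g = (m/f) Hess f = 0\<close>.
\<close>

section \<open>Closure properties of smooth functions\<close>

lemma differentiable_has_derivative:
  "F differentiable (at x) \<Longrightarrow> (F has_derivative frechet_derivative F (at x)) (at x)"
  by (simp add: frechet_derivative_works)

lemma Ck_on_cong:
  assumes "open S" "\<And>x. x \<in> S \<Longrightarrow> F x = G x" "Ck_on k S F"
  shows "Ck_on k S G"
  using assms(2,3)
proof (induction k arbitrary: F G)
  case 0
  then show ?case by (simp cong: continuous_on_cong)
next
  case (Suc k)
  have d: "frechet_derivative F (at x) = frechet_derivative G (at x)" if "x \<in> S" for x
    using frechet_derivative_transform_within_open[OF _ assms(1) that] Suc.prems that by auto
  have "G differentiable (at x)" if "x \<in> S" for x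
    using has_derivative_transform_within_open[OF _ assms(1) that] Suc.prems that
    unfolding differentiable_def by (metis Ck_on.simps(2) differentiable_def)
  moreover have "Ck_on k S (\<lambda>x. frechet_derivative G (at x) v)" for v
    using Suc.IH[of "\<lambda>x. frechet_derivative F (at x) v"] Suc.prems(2) d by simp
  ultimately show ?case by simp
qed

text \<open>Induction on the order of smoothness goes through this rule: a formula for the derivative, valid on
  the open set only, may stand in for \<^const>\<open>frechet_derivative\<close>.\<close>

lemma Ck_on_SucI:
  assumes "open S" "\<And>x. x \<in> S \<Longrightarrow> (F has_derivative F' x) (at x)"
    and "\<And>v. Ck_on k S (\<lambda>x. F' x v)"
  shows "Ck_on (Suc k) S F"
proof -
  have "frechet_derivative F (at x) = F' x" if "x \<in> S" for x
    using frechet_derivative_at[OF assms(2)[OF that]] by simp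
  then have "Ck_on k S (\<lambda>x. frechet_derivative F (at x) v)" for v
    by (intro Ck_on_cong[OF assms(1) _ assms(3)]) simp
  then show ?thesis using assms(2) by (auto simp: differentiable_def)
qed

lemma Ck_on_SucD:
  assumes "Ck_on (Suc k) S F"
  shows "Ck_on k S F"
  using assms
proof (induction k arbitrary: F)
  case 0
  then show ?case
    by (auto intro!: continuous_at_imp_continuous_on differentiable_imp_continuous_within)
next
  case (Suc k)
  then show ?case by (metis Ck_on.simps(2))
qed

lemma Ck_on_has_derivative:
  "Ck_on (Suc k) S F \<Longrightarrow> x \<in> S \<Longrightarrow> (F has_derivative frechet_derivative F (at x)) (at x)"
  by (simp add: differentiable_has_derivative)

lemma Ck_on_const: "open S \<Longrightarrow> Ck_on k S (\<lambda>x. c)"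
  by (induction k arbitrary: c) auto

lemma Ck_on_add:
  assumes "open S" "Ck_on k S F" "Ck_on k S G"
  shows "Ck_on k S (\<lambda>x. F x + G x)"
  using assms(2,3)
proof (induction k arbitrary: F G)
  case (Suc k)
  show ?case
    by (rule Ck_on_SucI[OF assms(1)],
        rule has_derivative_add[OF Ck_on_has_derivative[OF Suc.prems(1)] Ck_on_has_derivative[OF Suc.prems(2)]])
       (use Suc in simp_all)
qed (simp add: continuous_on_add)

lemma Ck_on_mult:
  fixes F G :: "'a::real_normed_vector \<Rightarrow> real"
  assumes "open S" "Ck_on k S F" "Ck_on k S G"
  shows "Ck_on k S (\<lambda>x. F x * G x)"
  using assms(2,3)
proof (induction k arbitrary: F G)
  case (Suc k)
  note low = Ck_on_SucD[OF Suc.prems(1)] Ck_on_SucD[OF Suc.prems(2)]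
  show ?case
    by (rule Ck_on_SucI[OF assms(1)],
        rule has_derivative_mult[OF Ck_on_has_derivative[OF Suc.prems(1)] Ck_on_has_derivative[OF Suc.prems(2)]])
       (use Suc low in \<open>auto intro!: Ck_on_add[OF assms(1)]\<close>)
qed (simp add: continuous_on_mult)

lemma Ck_on_inverse:
  fixes F :: "'a::real_normed_vector \<Rightarrow> real"
  assumes "open S" "Ck_on k S F" "\<And>x. x \<in> S \<Longrightarrow> F x \<noteq> 0"
  shows "Ck_on k S (\<lambda>x. inverse (F x))"
  using assms(2)
proof (induction k)
  case 0
  then show ?case using assms(3) by (simp add: continuous_on_inverse)
next
  case (Suc k)
  have inv: "Ck_on k S (\<lambda>x. inverse (F x))"
    using Suc.IH Ck_on_SucD[OF Suc.prems] .
  have "Ck_on k S (\<lambda>x. (- 1) * (inverse (F x) * frechet_derivative F (at x) v * inverse (F x)))" for v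
    using Suc.prems inv by (intro Ck_on_mult[OF assms(1)] Ck_on_const[OF assms(1)]) auto
  then have "Ck_on k S (\<lambda>x. - (inverse (F x) * frechet_derivative F (at x) v * inverse (F x)))" for v
    by simp
  moreover have "((\<lambda>x. inverse (F x)) has_derivative
      (\<lambda>v. - (inverse (F x) * frechet_derivative F (at x) v * inverse (F x)))) (at x)" if "x \<in> S" for x
    using Deriv.has_derivative_inverse[OF assms(3)[OF that] Ck_on_has_derivative[OF Suc.prems that]] .
  ultimately show ?case
    by (intro Ck_on_SucI[OF assms(1)])
qed

lemma Ck_on_linear_image:
  assumes "open S" "bounded_linear L" "Ck_on k S F"
  shows "Ck_on k S (\<lambda>x. L (F x))"
  using assms(3)
proof (induction k arbitrary: F)
  case 0
  then show ?case using bounded_linear.continuous_on[OF assms(2)] by simp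
next
  case (Suc k)
  show ?case
    by (rule Ck_on_SucI[OF assms(1) bounded_linear.has_derivative[OF assms(2) Ck_on_has_derivative[OF Suc.prems]]])
       (use Suc in simp_all)
qed

lemma Ck_on_linear_preimage:
  assumes "open T" "bounded_linear L" "L ` T \<subseteq> S" "Ck_on k S F"
  shows "Ck_on k T (\<lambda>x. F (L x))"
  using assms(4)
proof (induction k arbitrary: F)
  case 0
  have "continuous_on T L" by (simp add: assms(2) linear_continuous_on)
  then show ?case
    using 0 continuous_on_compose2[of S F T L] assms(3) by simp
next
  case (Suc k)
  have "((\<lambda>x. F (L x)) has_derivative (\<lambda>v. frechet_derivative F (at (L x)) (L v))) (at x)" if "x \<in> T" for x
    using has_derivative_compose[OF bounded_linear_imp_has_derivative[OF assms(2)]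
        Ck_on_has_derivative[OF Suc.prems]] that assms(3) by auto
  moreover have "Ck_on k T (\<lambda>x. frechet_derivative F (at (L x)) (L v))" for v
    using Suc.IH[of "\<lambda>y. frechet_derivative F (at y) (L v)"] Suc.prems by simp
  ultimately show ?case
    by (rule Ck_on_SucI[OF assms(1)])
qed

lemma smooth_on_cong:
  "open S \<Longrightarrow> (\<And>x. x \<in> S \<Longrightarrow> F x = G x) \<Longrightarrow> smooth_on S F \<Longrightarrow> smooth_on S G"
  unfolding smooth_on_def using Ck_on_cong by blast

lemma smooth_on_const: "open S \<Longrightarrow> smooth_on S (\<lambda>x. c)"
  by (simp add: smooth_on_def Ck_on_const)

lemma smooth_on_add: "open S \<Longrightarrow> smooth_on S F \<Longrightarrow> smooth_on S G \<Longrightarrow> smooth_on S (\<lambda>x. F x + G x)"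
  by (simp add: smooth_on_def Ck_on_add)

lemma smooth_on_mult:
  fixes F G :: "'a::real_normed_vector \<Rightarrow> real"
  shows "open S \<Longrightarrow> smooth_on S F \<Longrightarrow> smooth_on S G \<Longrightarrow> smooth_on S (\<lambda>x. F x * G x)"
  by (simp add: smooth_on_def Ck_on_mult)

lemma smooth_on_diff:
  fixes F G :: "'a::real_normed_vector \<Rightarrow> real"
  assumes "open S" "smooth_on S F" "smooth_on S G"
  shows "smooth_on S (\<lambda>x. F x - G x)"
  using smooth_on_add[OF assms(1,2) smooth_on_mult[OF assms(1) smooth_on_const[OF assms(1), of "-1"] assms(3)]]
  by simp

lemma smooth_on_divide:
  fixes F G :: "'a::real_normed_vector \<Rightarrow> real"
  assumes "open S" "smooth_on S F" "smooth_on S G" "\<And>x. x \<in> S \<Longrightarrow> G x \<noteq> 0"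
  shows "smooth_on S (\<lambda>x. F x / G x)"
  using assms by (simp add: smooth_on_def divide_inverse Ck_on_mult Ck_on_inverse)

lemma smooth_on_sum:
  assumes "open S" "\<And>i. i \<in> I \<Longrightarrow> smooth_on S (F i)"
  shows "smooth_on S (\<lambda>x. \<Sum>i\<in>I. F i x)"
  using assms(2)
  by (induction I rule: infinite_finite_induct) (auto intro!: smooth_on_add smooth_on_const assms(1))

lemma smooth_on_prod:
  fixes F :: "'i \<Rightarrow> 'a::real_normed_vector \<Rightarrow> real"
  assumes "open S" "\<And>i. i \<in> I \<Longrightarrow> smooth_on S (F i)"
  shows "smooth_on S (\<lambda>x. \<Prod>i\<in>I. F i x)"
  using assms(2)
  by (induction I rule: infinite_finite_induct) (auto intro!: smooth_on_mult smooth_on_const assms(1))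

lemma smooth_on_linear_preimage:
  "open T \<Longrightarrow> bounded_linear L \<Longrightarrow> L ` T \<subseteq> S \<Longrightarrow> smooth_on S F \<Longrightarrow> smooth_on T (\<lambda>x. F (L x))"
  unfolding smooth_on_def using Ck_on_linear_preimage by blast

lemma smooth_on_vec_nth:
  fixes F :: "'a::real_normed_vector \<Rightarrow> 'b::real_normed_vector ^ 'n::finite"
  shows "open S \<Longrightarrow> smooth_on S F \<Longrightarrow> smooth_on S (\<lambda>x. F x $ i)"
  unfolding smooth_on_def using Ck_on_linear_image[OF _ bounded_linear_vec_nth] by blast

lemma smooth_on_directional_derivative:
  "smooth_on S F \<Longrightarrow> smooth_on S (\<lambda>x. frechet_derivative F (at x) v)"
  unfolding smooth_on_def by (metis Ck_on.simps(2))

lemma smooth_on_partial: "smooth_on S F \<Longrightarrow> smooth_on S (partial k F)"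
  unfolding partial_def[abs_def] by (rule smooth_on_directional_derivative)

lemma smooth_on_differentiable: "smooth_on S F \<Longrightarrow> x \<in> S \<Longrightarrow> F differentiable (at x)"
  unfolding smooth_on_def by (metis Ck_on.simps(2))

lemma smooth_on_continuous: "smooth_on S F \<Longrightarrow> continuous_on S F"
  unfolding smooth_on_def by (metis Ck_on.simps(1))

section \<open>Partial derivatives\<close>

lemma partial_has_derivative: "(F has_derivative F') (at x) \<Longrightarrow> partial k F x = F' (axis k 1)"
  unfolding partial_def using frechet_derivative_at by metis

lemma partial_cong:
  assumes "open S" "x \<in> S" "\<And>y. y \<in> S \<Longrightarrow> F y = G y" "smooth_on S F"
  shows "partial k F x = partial k G x"
  unfolding partial_def
  using frechet_derivative_transform_within_open[OF smooth_on_differentiable[OF assms(4,2)] assms(1,2,3)] by simp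

lemma partial_const [simp]: "partial k (\<lambda>x. c) x = 0"
  by (simp add: partial_def)

lemma partial_add:
  "F differentiable (at x) \<Longrightarrow> G differentiable (at x) \<Longrightarrow>
    partial k (\<lambda>x. F x + G x) x = partial k F x + partial k G x"
  by (subst partial_has_derivative[OF has_derivative_add[OF differentiable_has_derivative differentiable_has_derivative]])
     (simp_all add: partial_def)

lemma partial_mult:
  "F differentiable (at x) \<Longrightarrow> G differentiable (at x) \<Longrightarrow>
    partial k (\<lambda>x. F x * G x) x = F x * partial k G x + partial k F x * G x"
  by (subst partial_has_derivative[OF has_derivative_mult[OF differentiable_has_derivative differentiable_has_derivative]])
     (simp_all add: partial_def)

lemma partial_divide:
  assumes "F differentiable (at x)" "G differentiable (at x)" "G x \<noteq> 0"
  shows "partial k (\<lambda>x. F x / G x) x = (partial k F x * G x - F x * partial k G x) / (G x)\<^sup>2"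
  using assms
  by (subst partial_has_derivative[OF has_derivative_divide'[OF differentiable_has_derivative differentiable_has_derivative]])
     (simp_all add: partial_def power2_eq_square)

lemma partial_sum:
  assumes "finite I" "\<And>i. i \<in> I \<Longrightarrow> F i differentiable (at x)"
  shows "partial k (\<lambda>x. \<Sum>i\<in>I. F i x) x = (\<Sum>i\<in>I. partial k (F i) x)"
  using assms by (induction I) (simp_all add: partial_add differentiable_sum)

section \<open>Symmetry of second derivatives\<close>

lemma line_MVT:
  fixes F :: "'a::real_normed_vector \<Rightarrow> real"
  assumes "0 < t" "\<And>s. 0 \<le> s \<Longrightarrow> s \<le> t \<Longrightarrow> F differentiable (at (x + s *\<^sub>R u))"
  obtains s where "0 < s" "s < t" "F (x + t *\<^sub>R u) - F x = t * frechet_derivative F (at (x + s *\<^sub>R u)) u"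
proof -
  have d: "((\<lambda>s. F (x + s *\<^sub>R u)) has_real_derivative frechet_derivative F (at (x + s *\<^sub>R u)) u) (at s)"
    if "0 \<le> s" "s \<le> t" for s
  proof -
    have "((\<lambda>s. x + s *\<^sub>R u) has_derivative (\<lambda>r. r *\<^sub>R u)) (at s)"
      by (auto intro!: derivative_eq_intros)
    from has_derivative_compose[OF this differentiable_has_derivative[OF assms(2)[OF that]]]
    have "((\<lambda>s. F (x + s *\<^sub>R u)) has_derivative (\<lambda>r. r * frechet_derivative F (at (x + s *\<^sub>R u)) u)) (at s)"
      by (simp add: linear_cmul[OF linear_frechet_derivative[OF assms(2)[OF that]]])
    then show ?thesis by (simp add: has_field_derivative_def mult_commute_abs)
  qed
  show ?thesis
    using MVT2[of 0 t "\<lambda>s. F (x + s *\<^sub>R u)", OF assms(1) d] that by auto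
qed

text \<open>Two applications of the mean value theorem, first along \<open>u\<close> and then along \<open>v\<close>, express a second
  difference that is symmetric in \<open>u\<close> and \<open>v\<close> by an iterated directional derivative in that order.\<close>

lemma second_difference:
  fixes F :: "'a::real_normed_vector \<Rightarrow> real"
  assumes S: "smooth_on S F" "ball x r \<subseteq> S" and t: "0 < t" "t * (norm u + norm v) < r"
  obtains y where "dist x y \<le> t * (norm u + norm v)"
    and "F (x + t *\<^sub>R u + t *\<^sub>R v) - F (x + t *\<^sub>R u) - F (x + t *\<^sub>R v) + F x =
      t * (t * frechet_derivative (\<lambda>z. frechet_derivative F (at z) u) (at y) v)"
proof -
  have near: "dist x (x + a *\<^sub>R u + b *\<^sub>R v) \<le> t * (norm u + norm v)"
    if "0 \<le> a" "a \<le> t" "0 \<le> b" "b \<le> t" for a b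
  proof -
    have "dist x (x + a *\<^sub>R u + b *\<^sub>R v) = norm (a *\<^sub>R u + b *\<^sub>R v)"
      by (metis add.assoc dist_commute dist_norm add_diff_cancel_left')
    also have "\<dots> \<le> a * norm u + b * norm v"
      by (metis norm_triangle_le norm_scaleR abs_of_nonneg order_refl that(1,3))
    also have "\<dots> \<le> t * norm u + t * norm v" using that by (intro add_mono mult_right_mono) auto
    finally show ?thesis by (simp add: algebra_simps)
  qed
  have inS: "x + a *\<^sub>R u + b *\<^sub>R v \<in> S" if "0 \<le> a" "a \<le> t" "0 \<le> b" "b \<le> t" for a b
    using near[OF that] t(2) S(2) by (auto simp: subset_iff)
  have dF: "(\<lambda>z. F (z + c)) differentiable (at z)" if "z + c \<in> S" for z c
    using differentiable_chain_at[of "\<lambda>z. z + c" z F] smooth_on_differentiable[OF S(1) that]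
    by (simp add: o_def)
  have fd: "frechet_derivative (\<lambda>z. F (z + c)) (at z) = frechet_derivative F (at (z + c))" if "z + c \<in> S" for z c
  proof -
    have "((\<lambda>z. z + c) has_derivative (\<lambda>h. h)) (at z)" by (auto intro!: derivative_eq_intros)
    from has_derivative_compose[OF this differentiable_has_derivative[OF smooth_on_differentiable[OF S(1) that]]]
    show ?thesis using frechet_derivative_at by fastforce
  qed
  let ?H = "\<lambda>z. F (z + t *\<^sub>R v) - F z"
  have dH: "?H differentiable (at (x + s *\<^sub>R u))"
     "frechet_derivative ?H (at (x + s *\<^sub>R u)) u =
      frechet_derivative F (at (x + s *\<^sub>R u + t *\<^sub>R v)) u - frechet_derivative F (at (x + s *\<^sub>R u)) u"
    if "0 \<le> s" "s \<le> t" for s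
  proof -
    have *: "x + s *\<^sub>R u + t *\<^sub>R v \<in> S" "x + s *\<^sub>R u \<in> S"
      using inS[of s t] inS[of s 0] that t(1) by auto
    show "?H differentiable (at (x + s *\<^sub>R u))"
      using dF[OF *(1)] smooth_on_differentiable[OF S(1) *(2)] by simp
    show "frechet_derivative ?H (at (x + s *\<^sub>R u)) u =
      frechet_derivative F (at (x + s *\<^sub>R u + t *\<^sub>R v)) u - frechet_derivative F (at (x + s *\<^sub>R u)) u"
      using frechet_derivative_at[OF has_derivative_diff[OF differentiable_has_derivative[OF dF[OF *(1)]]
           differentiable_has_derivative[OF smooth_on_differentiable[OF S(1) *(2)]]], symmetric] fd[OF *(1)]
      by simp
  qed
  obtain a where a: "0 < a" "a < t" "?H (x + t *\<^sub>R u) - ?H x = t * frechet_derivative ?H (at (x + a *\<^sub>R u)) u"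
    using line_MVT[of t ?H x u] t(1) dH(1) by blast
  obtain b where b: "0 < b" "b < t"
    "frechet_derivative F (at (x + a *\<^sub>R u + t *\<^sub>R v)) u - frechet_derivative F (at (x + a *\<^sub>R u)) u =
      t * frechet_derivative (\<lambda>z. frechet_derivative F (at z) u) (at (x + a *\<^sub>R u + b *\<^sub>R v)) v"
  proof (rule line_MVT[of t "\<lambda>z. frechet_derivative F (at z) u" "x + a *\<^sub>R u" v])
    show "(\<lambda>z. frechet_derivative F (at z) u) differentiable at (x + a *\<^sub>R u + s *\<^sub>R v)" if "0 \<le> s" "s \<le> t" for s
      by (rule smooth_on_differentiable[OF smooth_on_directional_derivative[OF S(1)]])
         (use inS[of a s] a that in auto)
  qed (use t(1) in auto)
  show ?thesis
  proof (rule that[of "x + a *\<^sub>R u + b *\<^sub>R v"])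
    show "dist x (x + a *\<^sub>R u + b *\<^sub>R v) \<le> t * (norm u + norm v)"
      using near[of a b] a b by auto
    show "F (x + t *\<^sub>R u + t *\<^sub>R v) - F (x + t *\<^sub>R u) - F (x + t *\<^sub>R v) + F x =
      t * (t * frechet_derivative (\<lambda>z. frechet_derivative F (at z) u) (at (x + a *\<^sub>R u + b *\<^sub>R v)) v)"
      using a(3) b(3) dH(2)[of a] a by (simp add: algebra_simps)
  qed
qed

text \<open>Both orders of differentiation give the same second difference up to nearby evaluation points;
  these points tend to \<open>x\<close> as the step \<open>t\<close> shrinks, and both second derivatives are continuous.\<close>

lemma directional_derivatives_commute:
  fixes F :: "'a::real_normed_vector \<Rightarrow> real"
  assumes S: "open S" "x \<in> S" "smooth_on S F"
  shows "frechet_derivative (\<lambda>z. frechet_derivative F (at z) u) (at x) v =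
         frechet_derivative (\<lambda>z. frechet_derivative F (at z) v) (at x) u"
proof -
  let ?D = "\<lambda>u v y. frechet_derivative (\<lambda>z. frechet_derivative F (at z) u) (at y) v"
  obtain r where r: "0 < r" "ball x r \<subseteq> S" using S(1,2) openE by blast
  have cont: "isCont (?D u v) x" for u v
    using smooth_on_continuous[OF smooth_on_directional_derivative[OF smooth_on_directional_derivative[OF S(3)]]]
      S(1,2) continuous_on_eq_continuous_at by blast
  have "dist (?D u v x) (?D v u x) < e" if e: "0 < e" for e
  proof -
    obtain d where d: "0 < d"
      "\<And>y. dist y x < d \<Longrightarrow> dist (?D u v y) (?D u v x) < e/2"
      "\<And>y. dist y x < d \<Longrightarrow> dist (?D v u y) (?D v u x) < e/2"
    proof -
      obtain d1 where "d1 > 0" "\<And>y. dist y x < d1 \<Longrightarrow> dist (?D u v y) (?D u v x) < e/2"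
        using cont[of u v] e unfolding continuous_at_eps_delta by (meson half_gt_zero)
      moreover obtain d2 where "d2 > 0" "\<And>y. dist y x < d2 \<Longrightarrow> dist (?D v u y) (?D v u x) < e/2"
        using cont[of v u] e unfolding continuous_at_eps_delta by (meson half_gt_zero)
      ultimately show ?thesis by (intro that[of "min d1 d2"]) auto
    qed
    \<comment> \<open>so small that both evaluation points lie in \<open>S\<close> and within the distance \<open>d\<close> of \<open>x\<close>\<close>
    define t where "t = min r d / (2 * (norm u + norm v + 1))"
    have pos: "norm u + norm v + 1 > 0" by (smt (verit) norm_ge_zero)
    have t: "0 < t" using r d pos by (simp add: t_def)
    have "t * (norm u + norm v) < t * (2 * (norm u + norm v + 1))"
      using t by (intro mult_strict_left_mono) (simp_all, smt (verit) norm_ge_zero)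
    also have "\<dots> = min r d" using pos by (simp add: t_def)
    finally have tr: "t * (norm u + norm v) < r" "t * (norm v + norm u) < r" "t * (norm u + norm v) < d"
      by (auto simp: add.commute)
    obtain y where y: "dist x y \<le> t * (norm u + norm v)"
      "F (x + t *\<^sub>R u + t *\<^sub>R v) - F (x + t *\<^sub>R u) - F (x + t *\<^sub>R v) + F x = t * (t * ?D u v y)"
      using second_difference[OF S(3) r(2) t tr(1)] by blast
    obtain y' where y': "dist x y' \<le> t * (norm v + norm u)"
      "F (x + t *\<^sub>R v + t *\<^sub>R u) - F (x + t *\<^sub>R v) - F (x + t *\<^sub>R u) + F x = t * (t * ?D v u y')"
      using second_difference[OF S(3) r(2) t tr(2)] by blast
    have swap: "x + t *\<^sub>R v + t *\<^sub>R u = x + t *\<^sub>R u + t *\<^sub>R v" by simp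
    have "t * (t * ?D u v y) = t * (t * ?D v u y')"
      using y(2) y'(2)[unfolded swap] by linarith
    then have "?D u v y = ?D v u y'" using t by simp
    moreover have "dist (?D u v y) (?D u v x) < e/2" "dist (?D v u y') (?D v u x) < e/2"
      using d(2)[of y] d(3)[of y'] y(1) y'(1) tr(3) by (auto simp: dist_commute add.commute)
    ultimately show ?thesis by (metis dist_commute dist_triangle_half_l)
  qed
  then show ?thesis by (metis dist_self less_irrefl zero_less_dist_iff)
qed

lemma partial_commute:
  assumes "open S" "x \<in> S" "smooth_on S F"
  shows "partial i (partial j F) x = partial j (partial i F) x"
  unfolding partial_def[abs_def] by (rule directional_derivatives_commute[OF assms])

section \<open>Matrices and positive semidefinite forms\<close>

lemma matrix_inv_cancel:
  fixes A :: "real ^ 'n ^ 'n::finite"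
  assumes "invertible A"
  shows "A ** matrix_inv A = mat 1" "matrix_inv A ** A = mat 1"
  using someI_ex[OF assms[unfolded invertible_def]] by (auto simp: matrix_inv_def)

lemma matrix_inv_eqI:
  fixes A B :: "real ^ 'n ^ 'n::finite"
  assumes "A ** B = mat 1" "B ** A = mat 1"
  shows "invertible A" "matrix_inv A = B"
proof -
  show inv: "invertible A" using assms by (auto simp: invertible_def)
  have "matrix_inv A = (B ** A) ** matrix_inv A" by (simp add: assms)
  also have "\<dots> = B" by (simp add: matrix_mul_assoc[symmetric] matrix_inv_cancel[OF inv])
  finally show "matrix_inv A = B" .
qed

text \<open>The value of the form at \<open>x + t e\<^sub>a\<close> is a nonnegative quadratic polynomial in \<open>t\<close>.\<close>

lemma psd_cauchy_schwarz:
  fixes P :: "'n::finite \<Rightarrow> 'n \<Rightarrow> real"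
  assumes sym: "\<And>i j. P i j = P j i" and psd: "\<And>x. 0 \<le> (\<Sum>i\<in>UNIV. \<Sum>j\<in>UNIV. x i * P i j * x j)"
  shows "(\<Sum>j\<in>UNIV. P a j * x j)\<^sup>2 \<le> P a a * (\<Sum>i\<in>UNIV. \<Sum>j\<in>UNIV. x i * P i j * x j)"
proof -
  let ?b = "\<Sum>j\<in>UNIV. P a j * x j" and ?Q = "\<Sum>i\<in>UNIV. \<Sum>j\<in>UNIV. x i * P i j * x j"
  \<comment> \<open>the standard basis vector in direction \<open>a\<close>\<close>
  define e where "e i = (if i = a then 1 else 0 :: real)" for i
  have e1: "(\<Sum>i\<in>UNIV. e i * c i) = c a" "(\<Sum>i\<in>UNIV. c i * e i) = c a" for c :: "'n \<Rightarrow> real"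
    by (simp_all add: e_def if_distrib[of "\<lambda>z. z * _"] if_distrib[of "\<lambda>z. _ * z"] cong: if_cong)
  have key: "0 \<le> ?Q + 2 * t * ?b + t\<^sup>2 * P a a" for t
  proof -
    have "(\<Sum>i\<in>UNIV. \<Sum>j\<in>UNIV. (x i + t * e i) * P i j * (x j + t * e j)) =
      ?Q + t * (\<Sum>i\<in>UNIV. x i * (\<Sum>j\<in>UNIV. P i j * e j)) + t * (\<Sum>i\<in>UNIV. e i * (\<Sum>j\<in>UNIV. P i j * x j))
        + t * t * (\<Sum>i\<in>UNIV. e i * (\<Sum>j\<in>UNIV. P i j * e j))"
      by (simp add: algebra_simps sum.distrib sum_distrib_left)
    moreover have "(\<Sum>i\<in>UNIV. x i * (\<Sum>j\<in>UNIV. P i j * e j)) = ?b"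
      unfolding e1 by (intro sum.cong refl) (simp add: sym[of _ a])
    ultimately show ?thesis using psd[of "\<lambda>i. x i + t * e i"]
      by (simp add: e1 power2_eq_square)
  qed
  have Pa: "0 \<le> P a a"
    using psd[of e] by (simp add: mult.assoc sum_distrib_left[symmetric] e1)
  show ?thesis
  proof (cases "P a a = 0")
    case True
    have "?b = 0"
    proof (rule ccontr)
      assume b: "?b \<noteq> 0"
      \<comment> \<open>the polynomial has degree one, and this is where it takes the value \<open>-1\<close>\<close>
      show False using key[of "- (?Q + 1) / (2 * ?b)"] b True by (simp add: field_simps)
    qed
    then show ?thesis using True by simp
  next
    case False
    \<comment> \<open>evaluate the polynomial at its minimum\<close>
    then have "0 \<le> P a a * (?Q + 2 * (- ?b / P a a) * ?b + (- ?b / P a a)\<^sup>2 * P a a)"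
      using key[of "- ?b / P a a"] Pa by (intro mult_nonneg_nonneg)
    also have "\<dots> = P a a * ?Q - ?b\<^sup>2"
      using False by (simp add: field_simps power2_eq_square)
    finally show ?thesis by simp
  qed
qed

text \<open>The Cholesky decomposition, one index at a time: for \<open>a\<close> with \<open>P\<^sub>a\<^sub>a > 0\<close>, subtracting
  \<open>P\<^sub>a\<^sub>i P\<^sub>a\<^sub>j / P\<^sub>a\<^sub>a\<close> clears row and column \<open>a\<close> and, by the Cauchy-Schwarz inequality, keeps the form
  positive semidefinite; if \<open>P\<^sub>a\<^sub>a = 0\<close>, that row and column are already zero.\<close>

lemma psd_sum_of_squares:
  fixes P :: "'n::finite \<Rightarrow> 'n \<Rightarrow> real"
  assumes "finite A" and "\<And>i j. P i j = P j i" and "\<And>x. 0 \<le> (\<Sum>i\<in>UNIV. \<Sum>j\<in>UNIV. x i * P i j * x j)"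
    and "\<And>i j. i \<notin> A \<Longrightarrow> P i j = 0"
  shows "\<exists>w. \<forall>i j. P i j = (\<Sum>k\<in>A. w k i * w k j)"
  using assms
proof (induction A arbitrary: P rule: finite_induct)
  case empty
  then show ?case by simp
next
  case (insert a A)
  note sym = insert.prems(1) and psd = insert.prems(2)
  note cs = psd_cauchy_schwarz[OF sym psd]
  have diag: "0 \<le> P i i" for i
    using psd[of "\<lambda>j. if j = i then 1 else 0"]
    by (simp add: if_distrib[of "\<lambda>z. z * _"] if_distrib[of "\<lambda>z. _ * z"] cong: if_cong)
  show ?case
  proof (cases "P a a = 0")
    case True
    have "P a j = 0" for j
      using cs[of a "\<lambda>i. if i = j then 1 else 0"] True
      by (simp add: if_distrib[of "\<lambda>z. _ * z"] cong: if_cong)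
    then have "P i j = 0" if "i \<notin> A" for i j
      using insert.prems(3)[of i j] that by (cases "i = a") auto
    then obtain w where w: "\<forall>i j. P i j = (\<Sum>k\<in>A. w k i * w k j)"
      using insert.IH[OF sym psd] by blast
    have "P i j = (\<Sum>k\<in>insert a A. (w(a := \<lambda>_. 0)) k i * (w(a := \<lambda>_. 0)) k j)" for i j
    proof -
      have "(\<Sum>k\<in>A. (w(a := \<lambda>_. 0)) k i * (w(a := \<lambda>_. 0)) k j) = (\<Sum>k\<in>A. w k i * w k j)"
        using insert.hyps(2) by (intro sum.cong) auto
      then show ?thesis using w insert.hyps by simp
    qed
    then show ?thesis by blast
  next
    case False
    define P' where "P' i j = P i j - P a i * P a j / P a a" for i j
    have "\<exists>w. \<forall>i j. P' i j = (\<Sum>k\<in>A. w k i * w k j)"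
    proof (rule insert.IH)
      show "P' i j = P' j i" for i j by (simp add: P'_def sym[of i j] mult.commute)
      show "0 \<le> (\<Sum>i\<in>UNIV. \<Sum>j\<in>UNIV. x i * P' i j * x j)" for x
      proof -
        have "(\<Sum>i\<in>UNIV. \<Sum>j\<in>UNIV. x i * P' i j * x j) =
            (\<Sum>i\<in>UNIV. \<Sum>j\<in>UNIV. x i * P i j * x j) - (\<Sum>j\<in>UNIV. P a j * x j)\<^sup>2 / P a a"
          unfolding P'_def power2_eq_square sum_product sum_divide_distrib sum_subtractf[symmetric]
          by (intro sum.cong refl) (simp add: algebra_simps)
        moreover have "(\<Sum>j\<in>UNIV. P a j * x j)\<^sup>2 / P a a \<le> (\<Sum>i\<in>UNIV. \<Sum>j\<in>UNIV. x i * P i j * x j)"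
          using cs[of a x] diag[of a] False by (simp add: pos_divide_le_eq mult.commute[of "P a a"])
        ultimately show ?thesis by simp
      qed
      show "P' i j = 0" if "i \<notin> A" for i j
      proof (cases "i = a")
        case True then show ?thesis using False by (simp add: P'_def)
      next
        case False
        then have "P i j = 0" "P i a = 0" using that insert.prems(3) by auto
        then show ?thesis by (simp add: P'_def sym[of a i])
      qed
    qed
    then obtain w where w: "P' i j = (\<Sum>k\<in>A. w k i * w k j)" for i j by blast
    define w' where "w' = w(a := \<lambda>i. P a i / sqrt (P a a))"
    have "P i j = (\<Sum>k\<in>insert a A. w' k i * w' k j)" for i j
    proof -
      have "(\<Sum>k\<in>A. w' k i * w' k j) = P' i j"
        unfolding w using insert.hyps(2) by (intro sum.cong) (auto simp: w'_def)
      moreover have "w' a i * w' a j = P a i * P a j / P a a"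
        using diag[of a] by (simp add: w'_def)
      ultimately show ?thesis using insert.hyps by (simp add: P'_def)
    qed
    then show ?thesis by blast
  qed
qed

text \<open>Write \<open>P = \<Sum>\<^sub>a w\<^sub>a w\<^sub>a\<^sup>T\<close>. Then \<open>tr (P H P H) = \<Sum>\<^sub>a\<^sub>b (w\<^sub>a\<^sup>T H w\<^sub>b)\<^sup>2\<close>, so if it vanishes,
  every \<open>w\<^sub>a\<^sup>T H w\<^sub>b\<close> does, and with them \<open>P H P\<close>. For \<open>P\<close> the inverse metric and \<open>H\<close> a Hessian, \<open>T\<close> is
  the Hessian with one index raised, and the trace is the squared norm of \<open>H\<close>.\<close>

lemma psd_trace_square_zero:
  fixes P H :: "'n::finite \<Rightarrow> 'n \<Rightarrow> real"
  assumes P: "\<And>i j. P i j = P j i" "\<And>x. 0 \<le> (\<Sum>i\<in>UNIV. \<Sum>j\<in>UNIV. x i * P i j * x j)"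
    and H: "\<And>i j. H i j = H j i"
    and T: "\<And>k l. T k l = (\<Sum>i\<in>UNIV. P k i * H i l)"
    and trace: "(\<Sum>k\<in>UNIV. \<Sum>l\<in>UNIV. T k l * T l k) = 0"
  shows "(\<Sum>l\<in>UNIV. P m l * T k l) = 0"
proof -
  have "\<exists>w. \<forall>i j. P i j = (\<Sum>k\<in>(UNIV :: 'n set). w k i * w k j)"
    by (rule psd_sum_of_squares[OF finite P]) simp
  then obtain w :: "'n \<Rightarrow> 'n \<Rightarrow> real" where w: "P i j = (\<Sum>a\<in>UNIV. w a i * w a j)" for i j
    by blast
  define u where "u a l = (\<Sum>i\<in>UNIV. w a i * H i l)" for a l
  define B where "B a b = (\<Sum>l\<in>UNIV. u a l * w b l)" for a b
  have Tu: "T k l = (\<Sum>a\<in>UNIV. w a k * u a l)" for k l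
    unfolding T w u_def sum_distrib_left sum_distrib_right by (subst sum.swap) (simp add: mult_ac)
  have Bsym: "B a b = B b a" for a b
    unfolding B_def u_def sum_distrib_left sum_distrib_right
    by (subst sum.swap) (simp add: H mult_ac cong: sum.cong)
  have "0 = (\<Sum>k\<in>UNIV. \<Sum>l\<in>UNIV. \<Sum>a\<in>UNIV. \<Sum>b\<in>UNIV. (w a k * u b k) * (u a l * w b l))"
    using trace unfolding Tu sum_product by (simp add: mult_ac)
  also have "\<dots> = (\<Sum>k\<in>UNIV. \<Sum>a\<in>UNIV. \<Sum>l\<in>UNIV. \<Sum>b\<in>UNIV. (w a k * u b k) * (u a l * w b l))"
    by (rule sum.cong[OF refl], rule sum.swap)
  also have "\<dots> = (\<Sum>k\<in>UNIV. \<Sum>a\<in>UNIV. \<Sum>b\<in>UNIV. \<Sum>l\<in>UNIV. (w a k * u b k) * (u a l * w b l))"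
    by (rule sum.cong[OF refl], rule sum.cong[OF refl], rule sum.swap)
  also have "\<dots> = (\<Sum>k\<in>UNIV. \<Sum>a\<in>UNIV. \<Sum>b\<in>UNIV. w a k * u b k * B a b)"
    unfolding B_def sum_distrib_left ..
  also have "\<dots> = (\<Sum>a\<in>UNIV. \<Sum>k\<in>UNIV. \<Sum>b\<in>UNIV. w a k * u b k * B a b)"
    by (rule sum.swap)
  also have "\<dots> = (\<Sum>a\<in>UNIV. \<Sum>b\<in>UNIV. \<Sum>k\<in>UNIV. w a k * u b k * B a b)"
    by (rule sum.cong[OF refl], rule sum.swap)
  also have "\<dots> = (\<Sum>a\<in>UNIV. \<Sum>b\<in>UNIV. (B a b)\<^sup>2)"
  proof (intro sum.cong refl)
    fix a b
    have "(\<Sum>k\<in>UNIV. w a k * u b k) = B a b"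
      unfolding Bsym[of a b] by (simp add: B_def mult.commute)
    then show "(\<Sum>k\<in>UNIV. w a k * u b k * B a b) = (B a b)\<^sup>2"
      by (simp add: power2_eq_square flip: sum_distrib_right)
  qed
  finally have "(\<Sum>b\<in>UNIV. (B a b)\<^sup>2) = 0" for a
    by (simp add: sum_nonneg_eq_0_iff sum_nonneg)
  then have B0: "B a b = 0" for a b
    by (simp add: sum_nonneg_eq_0_iff)
  have "(\<Sum>l\<in>UNIV. P m l * T k l) = (\<Sum>l\<in>UNIV. \<Sum>b\<in>UNIV. \<Sum>a\<in>UNIV. w b m * w a k * (u a l * w b l))"
    unfolding Tu w sum_product by (simp add: mult_ac)
  also have "\<dots> = (\<Sum>b\<in>UNIV. \<Sum>l\<in>UNIV. \<Sum>a\<in>UNIV. w b m * w a k * (u a l * w b l))"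
    by (rule sum.swap)
  also have "\<dots> = (\<Sum>b\<in>UNIV. \<Sum>a\<in>UNIV. \<Sum>l\<in>UNIV. w b m * w a k * (u a l * w b l))"
    by (rule sum.cong[OF refl], rule sum.swap)
  also have "\<dots> = (\<Sum>b\<in>UNIV. \<Sum>a\<in>UNIV. w b m * w a k * B a b)"
    unfolding B_def sum_distrib_left ..
  finally show ?thesis by (simp add: B0)
qed

section \<open>The Levi-Civita connection in a chart\<close>

definition gradient :: "(real ^ 'n \<Rightarrow> real ^ 'n ^ 'n) \<Rightarrow> (real ^ 'n \<Rightarrow> real) \<Rightarrow> 'n
    \<Rightarrow> real ^ 'n::finite \<Rightarrow> real" where
  "gradient G F i x = (\<Sum>j\<in>UNIV. matrix_inv (G x) $ i $ j * partial j F x)"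

definition hessian :: "(real ^ 'n \<Rightarrow> real ^ 'n ^ 'n) \<Rightarrow> (real ^ 'n \<Rightarrow> real) \<Rightarrow> 'n \<Rightarrow> 'n
    \<Rightarrow> real ^ 'n::finite \<Rightarrow> real" where
  "hessian G F i j x = partial i (partial j F) x - (\<Sum>p\<in>UNIV. christoffel G p i j x * partial p F x)"

text \<open>The component \<open>\<nabla>\<^sub>j V\<^sup>k\<close>, for a vector field \<open>V\<close> given by its component functions.\<close>

definition covariant_derivative :: "(real ^ 'n \<Rightarrow> real ^ 'n ^ 'n) \<Rightarrow> ('n \<Rightarrow> real ^ 'n \<Rightarrow> real) \<Rightarrow> 'n \<Rightarrow> 'n
    \<Rightarrow> real ^ 'n::finite \<Rightarrow> real" where
  "covariant_derivative G V k j x = partial j (V k) x + (\<Sum>l\<in>UNIV. christoffel G k j l x * V l x)"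

text \<open>The coordinate expression of a semi-Riemannian metric in one chart. Indices are lowered by summing
  against \<open>G\<close> and raised by summing against its inverse. The identities for the gradient and its
  derivative are obtained in lowered form, which avoids differentiating the inverse matrix.\<close>

locale metric_patch =
  fixes S :: "(real ^ 'n::finite) set" and G :: "real ^ 'n \<Rightarrow> real ^ 'n ^ 'n"
  assumes open_S: "open S" and component_smooth: "smooth_on S (\<lambda>x. G x $ i $ j)"
    and sym: "x \<in> S \<Longrightarrow> G x $ i $ j = G x $ j $ i"
    and invertible: "x \<in> S \<Longrightarrow> invertible (G x)"
begin

lemma inverse_left: "x \<in> S \<Longrightarrow> (\<Sum>j\<in>UNIV. matrix_inv (G x) $ i $ j * G x $ j $ k) = (if i = k then 1 else 0)"
  using matrix_inv_cancel(2)[OF invertible] by (auto simp: matrix_matrix_mult_def vec_eq_iff mat_def)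

lemma inverse_right: "x \<in> S \<Longrightarrow> (\<Sum>j\<in>UNIV. G x $ i $ j * matrix_inv (G x) $ j $ k) = (if i = k then 1 else 0)"
  using matrix_inv_cancel(1)[OF invertible] by (auto simp: matrix_matrix_mult_def vec_eq_iff mat_def)

lemma lower_raise:
  assumes "x \<in> S"
  shows "(\<Sum>k\<in>UNIV. G x $ l $ k * (\<Sum>m\<in>UNIV. matrix_inv (G x) $ k $ m * E m)) = E l"
proof -
  have "(\<Sum>k\<in>UNIV. G x $ l $ k * (\<Sum>m\<in>UNIV. matrix_inv (G x) $ k $ m * E m)) =
    (\<Sum>m\<in>UNIV. (\<Sum>k\<in>UNIV. G x $ l $ k * matrix_inv (G x) $ k $ m) * E m)"
    unfolding sum_distrib_left sum_distrib_right by (subst sum.swap) (simp add: mult.assoc)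
  then show ?thesis by (simp add: inverse_right[OF assms] if_distrib[of "\<lambda>c. c * _"] cong: if_cong)
qed

lemma raise_lower:
  assumes "x \<in> S"
  shows "(\<Sum>k\<in>UNIV. matrix_inv (G x) $ l $ k * (\<Sum>m\<in>UNIV. G x $ k $ m * E m)) = E l"
proof -
  have "(\<Sum>k\<in>UNIV. matrix_inv (G x) $ l $ k * (\<Sum>m\<in>UNIV. G x $ k $ m * E m)) =
    (\<Sum>m\<in>UNIV. (\<Sum>k\<in>UNIV. matrix_inv (G x) $ l $ k * G x $ k $ m) * E m)"
    unfolding sum_distrib_left sum_distrib_right by (subst sum.swap) (simp add: mult.assoc)
  then show ?thesis by (simp add: inverse_left[OF assms] if_distrib[of "\<lambda>c. c * _"] cong: if_cong)
qed

lemma inverse_symmetric: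
  assumes "x \<in> S"
  shows "matrix_inv (G x) $ i $ j = matrix_inv (G x) $ j $ i"
proof -
  have "(\<Sum>m\<in>UNIV. G x $ k $ m * matrix_inv (G x) $ j $ m) = (if j = k then 1 else 0)" for k
    using inverse_left[OF assms, of j k] sym[OF assms] by (simp add: mult.commute)
  then have "matrix_inv (G x) $ j $ i = (\<Sum>k\<in>UNIV. matrix_inv (G x) $ i $ k * (if j = k then 1 else 0))"
    using raise_lower[OF assms, of i "\<lambda>m. matrix_inv (G x) $ j $ m"] by simp
  then show ?thesis by (simp add: if_distrib[of "\<lambda>c. _ * c"] cong: if_cong)
qed

text \<open>By Cramer's rule the entries of the inverse are quotients of determinants, which are polynomials in
  the entries of \<open>G\<close>.\<close>

lemma inverse_smooth: "smooth_on S (\<lambda>x. matrix_inv (G x) $ i $ j)"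
proof -
  let ?M = "\<lambda>x. (\<chi> r c. if c = i then axis j 1 $ r else G x $ r $ c) :: real ^ 'n ^ 'n"
  have det_smooth: "smooth_on S (\<lambda>x. det (A x))" if "\<And>r c. smooth_on S (\<lambda>x. A x $ r $ c)" for A :: "real ^ 'n \<Rightarrow> real ^ 'n ^ 'n"
    unfolding det_def
    by (intro smooth_on_sum smooth_on_mult smooth_on_prod smooth_on_const open_S that)
  have "smooth_on S (\<lambda>x. ?M x $ r $ c)" for r c
    by (cases "c = i") (auto intro: smooth_on_const open_S component_smooth)
  then have "smooth_on S (\<lambda>x. det (?M x) / det (G x))"
    by (intro smooth_on_divide det_smooth open_S component_smooth)
       (use invertible in \<open>auto simp: invertible_det_nz\<close>)
  moreover have "det (?M x) / det (G x) = matrix_inv (G x) $ i $ j" if x: "x \<in> S" for x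
  proof -
    have "G x *v (matrix_inv (G x) *v axis j 1) = axis j 1"
      by (simp add: matrix_vector_mul_assoc matrix_inv_cancel(1)[OF invertible[OF x]])
    then have "matrix_inv (G x) *v axis j 1 = (\<chi> k. det (\<chi> r c. if c = k then axis j 1 $ r else G x $ r $ c) / det (G x))"
      using cramer[of "G x"] invertible[OF x] by (simp add: invertible_det_nz)
    then show ?thesis
      by (simp add: matrix_vector_mult_basis column_def vec_eq_iff)
  qed
  ultimately show ?thesis by (rule smooth_on_cong[OF open_S, rotated])
qed

lemma christoffel_smooth: "smooth_on S (christoffel G k i j)"
  unfolding christoffel_def[abs_def]
  by (intro smooth_on_divide smooth_on_sum smooth_on_mult smooth_on_add smooth_on_diff open_S
        smooth_on_const inverse_smooth smooth_on_partial component_smooth) auto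

lemma partial_symmetric: "x \<in> S \<Longrightarrow> partial k (\<lambda>y. G y $ i $ j) x = partial k (\<lambda>y. G y $ j $ i) x"
  by (rule partial_cong[OF open_S _ sym component_smooth])

lemma christoffel_symmetric: "x \<in> S \<Longrightarrow> christoffel G k i j x = christoffel G k j i x"
  unfolding christoffel_def using partial_symmetric[of x _ i j] by (simp add: add.commute)

lemma lower_christoffel:
  assumes "x \<in> S"
  shows "(\<Sum>k\<in>UNIV. G x $ l $ k * christoffel G k i j x) =
    (partial i (\<lambda>y. G y $ j $ l) x + partial j (\<lambda>y. G y $ i $ l) x - partial l (\<lambda>y. G y $ i $ j) x) / 2"
  using lower_raise[OF assms, of l "\<lambda>l. partial i (\<lambda>y. G y $ j $ l) x + partial j (\<lambda>y. G y $ i $ l) x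
          - partial l (\<lambda>y. G y $ i $ j) x"]
  by (simp add: christoffel_def sum_divide_distrib[symmetric])

text \<open>This is \<open>\<nabla>G = 0\<close>: add two instances of \<open>lower_christoffel\<close>, in which all
  derivatives but \<open>\<partial>\<^sub>k G\<^sub>i\<^sub>j\<close> cancel.\<close>

lemma metric_compatible:
  assumes "x \<in> S"
  shows "partial k (\<lambda>y. G y $ i $ j) x =
    (\<Sum>l\<in>UNIV. G x $ i $ l * christoffel G l k j x) + (\<Sum>l\<in>UNIV. G x $ j $ l * christoffel G l k i x)"
  unfolding lower_christoffel[OF assms]
  using partial_symmetric[OF assms, of k i j] partial_symmetric[OF assms, of i k j]
    partial_symmetric[OF assms, of j k i]
  by (simp add: field_simps)

lemma gradient_smooth: "smooth_on S F \<Longrightarrow> smooth_on S (gradient G F i)"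
  unfolding gradient_def[abs_def]
  by (intro smooth_on_sum smooth_on_mult open_S inverse_smooth smooth_on_partial)

lemma covariant_smooth: "(\<And>i. smooth_on S (V i)) \<Longrightarrow> smooth_on S (covariant_derivative G V k j)"
  unfolding covariant_derivative_def[abs_def]
  by (intro smooth_on_add smooth_on_sum smooth_on_mult open_S christoffel_smooth smooth_on_partial)

lemma lower_gradient: "x \<in> S \<Longrightarrow> (\<Sum>j\<in>UNIV. G x $ i $ j * gradient G F j x) = partial i F x"
  unfolding gradient_def by (rule lower_raise)

lemma hessian_symmetric: "smooth_on S F \<Longrightarrow> x \<in> S \<Longrightarrow> hessian G F i j x = hessian G F j i x"
  unfolding hessian_def using partial_commute[OF open_S, of x F i j] christoffel_symmetric[of x _ i j] by simp

lemma differentiable_facts: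
  assumes "x \<in> S"
  shows "(\<lambda>y. G y $ i $ j) differentiable (at x)" "christoffel G k i j differentiable (at x)"
  using assms component_smooth christoffel_smooth smooth_on_differentiable by blast+

text \<open>Differentiate \<open>\<Sum>\<^sub>j G\<^sub>i\<^sub>j V\<^sup>j = \<partial>\<^sub>i F\<close> and use that the metric is parallel: the covariant derivative of
  the gradient is the Hessian with one index raised.\<close>

lemma lower_covariant_gradient:
  assumes F: "smooth_on S F" and x: "x \<in> S"
  shows "(\<Sum>j\<in>UNIV. G x $ i $ j * covariant_derivative G (gradient G F) j k x) = hessian G F k i x"
proof -
  let ?V = "gradient G F" and ?\<Gamma> = "\<lambda>k i j. christoffel G k i j x"
  note dV = smooth_on_differentiable[OF gradient_smooth[OF F] x]
  have "partial k (partial i F) x = partial k (\<lambda>y. \<Sum>j\<in>UNIV. G y $ i $ j * ?V j y) x"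
    by (rule partial_cong[OF open_S x]) (auto simp: lower_gradient intro: smooth_on_partial F)
  also have "\<dots> = (\<Sum>j\<in>UNIV. G x $ i $ j * partial k (?V j) x) + (\<Sum>j\<in>UNIV. partial k (\<lambda>y. G y $ i $ j) x * ?V j x)"
    by (subst partial_sum) (auto simp: partial_mult differentiable_facts[OF x] dV sum.distrib)
  also have "(\<Sum>j\<in>UNIV. partial k (\<lambda>y. G y $ i $ j) x * ?V j x) =
     (\<Sum>j\<in>UNIV. (\<Sum>l\<in>UNIV. G x $ i $ l * ?\<Gamma> l k j) * ?V j x)
      + (\<Sum>j\<in>UNIV. (\<Sum>l\<in>UNIV. G x $ j $ l * ?\<Gamma> l k i) * ?V j x)"
    by (simp add: metric_compatible[OF x] distrib_right sum.distrib)
  also have "(\<Sum>j\<in>UNIV. (\<Sum>l\<in>UNIV. G x $ i $ l * ?\<Gamma> l k j) * ?V j x) =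
      (\<Sum>l\<in>UNIV. G x $ i $ l * (\<Sum>j\<in>UNIV. ?\<Gamma> l k j * ?V j x))"
    unfolding sum_distrib_left sum_distrib_right by (subst sum.swap) (simp add: mult.assoc)
  also have "(\<Sum>j\<in>UNIV. (\<Sum>l\<in>UNIV. G x $ j $ l * ?\<Gamma> l k i) * ?V j x) =
      (\<Sum>l\<in>UNIV. ?\<Gamma> l k i * (\<Sum>j\<in>UNIV. G x $ l $ j * ?V j x))"
    unfolding sum_distrib_left sum_distrib_right
    by (subst sum.swap) (simp add: sym[OF x, of _ "_::'n"] mult_ac cong: sum.cong)
  finally show ?thesis
    by (simp add: hessian_def covariant_derivative_def distrib_left sum.distrib lower_gradient[OF x])
qed

lemma covariant_gradient_raise:
  assumes F: "smooth_on S F" and x: "x \<in> S"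
  shows "covariant_derivative G (gradient G F) j k x = (\<Sum>i\<in>UNIV. matrix_inv (G x) $ j $ i * hessian G F i k x)"
  using raise_lower[OF x, of j "\<lambda>j. covariant_derivative G (gradient G F) j k x"]
  by (simp add: lower_covariant_gradient[OF F x] hessian_symmetric[OF F x, of k])

section \<open>The Ricci identity and gradients of constant length\<close>

text \<open>The left-hand side is \<open>\<nabla>\<^sub>k \<nabla>\<^sub>j V\<^sup>k - \<nabla>\<^sub>j \<nabla>\<^sub>k V\<^sup>k\<close>, summed over \<open>k\<close>. Expanding, the second derivatives of
  \<open>V\<close> cancel because they are symmetric, the first derivatives because the Christoffel symbols are, and
  what multiplies \<open>V\<close> is the expression that defines the Ricci tensor.\<close>

lemma ricci_identity:
  assumes V: "\<And>i. smooth_on S (V i)" and x: "x \<in> S"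
  shows "(\<Sum>k\<in>UNIV. partial k (covariant_derivative G V k j) x
       + (\<Sum>l\<in>UNIV. christoffel G k k l x * covariant_derivative G V l j x)
       - (\<Sum>l\<in>UNIV. christoffel G l k j x * covariant_derivative G V k l x))
     - partial j (\<lambda>y. \<Sum>k\<in>UNIV. covariant_derivative G V k k y) x
   = (\<Sum>l\<in>UNIV. ricci G x $ j $ l * V l x)"
proof -
  let ?\<Gamma> = "\<lambda>k i j. christoffel G k i j x" and ?d\<Gamma> = "\<lambda>m k i j. partial m (christoffel G k i j) x"
  let ?d = "\<lambda>k i. partial k (V i) x" and ?v = "\<lambda>i. V i x"
  note diff = differentiable_facts[OF x] smooth_on_differentiable[OF V x]
     smooth_on_differentiable[OF smooth_on_partial[OF V] x]
     smooth_on_differentiable[OF covariant_smooth[OF V] x]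
  have dcov: "partial m (covariant_derivative G V k i) x = partial m (partial i (V k)) x +
     ((\<Sum>l\<in>UNIV. ?\<Gamma> k i l * ?d m l) + (\<Sum>l\<in>UNIV. ?d\<Gamma> m k i l * ?v l))" for m k i
    unfolding covariant_derivative_def[abs_def]
    by (simp add: partial_add partial_sum partial_mult diff sum.distrib)
  have div: "partial j (\<lambda>y. \<Sum>k\<in>UNIV. covariant_derivative G V k k y) x = (\<Sum>k\<in>UNIV. partial j (covariant_derivative G V k k) x)"
    by (rule partial_sum) (auto simp: diff)
  have "(\<Sum>k\<in>UNIV. \<Sum>l\<in>UNIV. ?\<Gamma> k j l * ?d k l) = (\<Sum>k\<in>UNIV. \<Sum>l\<in>UNIV. ?\<Gamma> l k j * ?d l k)"
    by (subst sum.swap) (simp add: christoffel_symmetric[OF x, of _ _ j])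
  moreover have "(\<Sum>k\<in>UNIV. \<Sum>l\<in>UNIV. \<Sum>p\<in>UNIV. ?\<Gamma> l k j * (?\<Gamma> k l p * ?v p)) =
     (\<Sum>k\<in>UNIV. \<Sum>l\<in>UNIV. \<Sum>p\<in>UNIV. ?\<Gamma> k j p * ?\<Gamma> p k l * ?v l)"
  proof -
    have "(\<Sum>k\<in>UNIV. \<Sum>l\<in>UNIV. \<Sum>p\<in>UNIV. ?\<Gamma> k j p * ?\<Gamma> p k l * ?v l) =
        (\<Sum>k\<in>UNIV. \<Sum>p\<in>UNIV. \<Sum>l\<in>UNIV. ?\<Gamma> k j p * ?\<Gamma> p k l * ?v l)"
      by (intro sum.cong refl sum.swap)
    also have "\<dots> = (\<Sum>p\<in>UNIV. \<Sum>k\<in>UNIV. \<Sum>l\<in>UNIV. ?\<Gamma> k j p * ?\<Gamma> p k l * ?v l)"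
      by (rule sum.swap)
    finally show ?thesis by (simp add: christoffel_symmetric[OF x, of _ j] mult.assoc)
  qed
  moreover have "(\<Sum>k\<in>UNIV. \<Sum>l\<in>UNIV. \<Sum>p\<in>UNIV. ?\<Gamma> k k l * (?\<Gamma> l j p * ?v p)) =
     (\<Sum>k\<in>UNIV. \<Sum>l\<in>UNIV. \<Sum>p\<in>UNIV. ?\<Gamma> k k p * ?\<Gamma> p j l * ?v l)"
    by (rule sum.cong[OF refl], subst sum.swap) (simp add: mult.assoc)
  moreover have "(\<Sum>l\<in>UNIV. ricci G x $ j $ l * V l x) =
      (\<Sum>k\<in>UNIV. \<Sum>l\<in>UNIV. ?d\<Gamma> k k j l * ?v l) - (\<Sum>k\<in>UNIV. \<Sum>l\<in>UNIV. ?d\<Gamma> j k k l * ?v l)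
     + (\<Sum>k\<in>UNIV. \<Sum>l\<in>UNIV. \<Sum>p\<in>UNIV. ?\<Gamma> k k p * ?\<Gamma> p j l * ?v l)
     - (\<Sum>k\<in>UNIV. \<Sum>l\<in>UNIV. \<Sum>p\<in>UNIV. ?\<Gamma> k j p * ?\<Gamma> p k l * ?v l)"
    unfolding ricci_def riemann_def
    by (simp add: sum_distrib_right, subst sum.swap)
       (simp add: sum.distrib sum_subtractf left_diff_distrib distrib_right sum_distrib_right sum_distrib_left algebra_simps)
  ultimately show ?thesis
    unfolding div dcov
    by (simp add: covariant_derivative_def partial_commute[OF open_S x V, of _ j] distrib_left
         sum.distrib sum_subtractf sum_distrib_left)
qed


text \<open>The derivative of \<open>\<bar>\<nabla>F\<bar>\<^sup>2\<close> along \<open>\<partial>\<^sub>k\<close> is \<open>2 Hess F (\<partial>\<^sub>k, \<nabla>F)\<close>: in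
  \<open>\<Sum>\<^sub>i V\<^sup>i \<partial>\<^sub>i F\<close> each factor contributes the Hessian term once, and the Christoffel terms cancel.\<close>

lemma hessian_gradient_zero:
  assumes F: "smooth_on S F" and x: "x \<in> S"
    and const: "\<And>y. y \<in> S \<Longrightarrow> (\<Sum>i\<in>UNIV. gradient G F i y * partial i F y) = c"
  shows "(\<Sum>i\<in>UNIV. hessian G F k i x * gradient G F i x) = 0"
proof -
  let ?V = "gradient G F" and ?\<Gamma> = "\<lambda>k i j. christoffel G k i j x"
  note diff = smooth_on_differentiable[OF gradient_smooth[OF F] x]
     smooth_on_differentiable[OF smooth_on_partial[OF F] x]
  have "0 = partial k (\<lambda>y. \<Sum>i\<in>UNIV. ?V i y * partial i F y) x"
    using partial_cong[OF open_S x const[symmetric] smooth_on_const[OF open_S]] by simp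
  also have "\<dots> = (\<Sum>i\<in>UNIV. ?V i x * partial k (partial i F) x) + (\<Sum>i\<in>UNIV. partial k (?V i) x * partial i F x)"
    by (simp add: partial_sum partial_mult diff sum.distrib)
  also have "(\<Sum>i\<in>UNIV. partial k (?V i) x * partial i F x) =
     (\<Sum>i\<in>UNIV. covariant_derivative G ?V i k x * partial i F x) - (\<Sum>i\<in>UNIV. (\<Sum>l\<in>UNIV. ?\<Gamma> i k l * ?V l x) * partial i F x)"
    by (simp add: covariant_derivative_def distrib_right sum.distrib)
  also have "(\<Sum>i\<in>UNIV. covariant_derivative G ?V i k x * partial i F x) =
     (\<Sum>j\<in>UNIV. (\<Sum>i\<in>UNIV. G x $ j $ i * covariant_derivative G ?V i k x) * ?V j x)"
    unfolding lower_gradient[OF x, symmetric] sum_distrib_left sum_distrib_right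
    by (subst sum.swap) (simp add: sym[OF x, of _ "_::'n"] mult_ac cong: sum.cong)
  also have "\<dots> = (\<Sum>j\<in>UNIV. hessian G F k j x * ?V j x)"
    by (simp add: lower_covariant_gradient[OF F x])
  also have "(\<Sum>i\<in>UNIV. (\<Sum>l\<in>UNIV. ?\<Gamma> i k l * ?V l x) * partial i F x) =
     (\<Sum>l\<in>UNIV. ?V l x * (\<Sum>i\<in>UNIV. ?\<Gamma> i k l * partial i F x))"
    unfolding sum_distrib_left sum_distrib_right by (subst sum.swap) (simp add: mult_ac)
  also have "(\<Sum>i\<in>UNIV. ?V i x * partial k (partial i F) x) =
     (\<Sum>j\<in>UNIV. hessian G F k j x * ?V j x) + (\<Sum>l\<in>UNIV. ?V l x * (\<Sum>i\<in>UNIV. ?\<Gamma> i k l * partial i F x))"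
    by (simp add: hessian_def right_diff_distrib left_diff_distrib sum_subtractf sum_distrib_right sum_distrib_left mult_ac)
  finally show ?thesis by simp
qed

lemma covariant_gradient_gradient_zero:
  assumes F: "smooth_on S F" and x: "x \<in> S"
    and const: "\<And>y. y \<in> S \<Longrightarrow> (\<Sum>i\<in>UNIV. gradient G F i y * partial i F y) = c"
  shows "(\<Sum>j\<in>UNIV. covariant_derivative G (gradient G F) k j x * gradient G F j x) = 0"
proof -
  have "(\<Sum>j\<in>UNIV. covariant_derivative G (gradient G F) k j x * gradient G F j x) =
    (\<Sum>i\<in>UNIV. matrix_inv (G x) $ k $ i * (\<Sum>j\<in>UNIV. hessian G F i j x * gradient G F j x))"
    unfolding covariant_gradient_raise[OF F x] sum_distrib_left sum_distrib_right
    by (subst sum.swap) (simp add: mult.assoc)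
  then show ?thesis by (simp add: hessian_gradient_zero[OF assms])
qed

text \<open>Bochner's formula when \<open>\<bar>\<nabla>F\<bar>\<^sup>2\<close> is constant and \<open>F\<close> harmonic. In the Ricci identity contracted with \<open>V\<close>,
  the term \<open>V\<^sup>j \<nabla>\<^sub>j (tr T)\<close> is zero, and \<open>V\<^sup>j \<nabla>\<^sub>k T\<^sup>k\<^sub>j = - T\<^sup>k\<^sub>j \<nabla>\<^sub>k V\<^sup>j\<close> because \<open>T V = 0\<close> on the
  whole chart.\<close>

lemma bochner_constant_length:
  assumes F: "smooth_on S F" and x: "x \<in> S"
    and const: "\<And>y. y \<in> S \<Longrightarrow> (\<Sum>i\<in>UNIV. gradient G F i y * partial i F y) = c"
    and harmonic: "\<And>y. y \<in> S \<Longrightarrow> (\<Sum>k\<in>UNIV. covariant_derivative G (gradient G F) k k y) = 0"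
  shows "(\<Sum>k\<in>UNIV. \<Sum>l\<in>UNIV. covariant_derivative G (gradient G F) k l x * covariant_derivative G (gradient G F) l k x) =
     - (\<Sum>j\<in>UNIV. \<Sum>l\<in>UNIV. ricci G x $ j $ l * gradient G F j x * gradient G F l x)"
proof -
  let ?V = "gradient G F" and ?\<Gamma> = "\<lambda>k i j. christoffel G k i j x"
  let ?T = "covariant_derivative G (gradient G F)"
  note V = gradient_smooth[OF F]
  note T = covariant_smooth[of ?V, OF V]
  note diff = smooth_on_differentiable[OF V x] smooth_on_differentiable[OF T x]
  have TV: "(\<Sum>j\<in>UNIV. ?T k j y * ?V j y) = 0" if "y \<in> S" for k y
    by (rule covariant_gradient_gradient_zero[OF F that const])
  have dTV: "(\<Sum>j\<in>UNIV. partial k (?T k j) x * ?V j x) = - (\<Sum>j\<in>UNIV. ?T k j x * partial k (?V j) x)" for k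
  proof -
    have "0 = partial k (\<lambda>y. \<Sum>j\<in>UNIV. ?T k j y * ?V j y) x"
      using partial_cong[OF open_S x TV[symmetric] smooth_on_const[OF open_S]] by simp
    then show ?thesis by (simp add: partial_sum partial_mult diff sum.distrib)
  qed
  have dharm: "partial j (\<lambda>y. \<Sum>k\<in>UNIV. ?T k k y) x = 0" for j
    using partial_cong[OF open_S x harmonic[symmetric] smooth_on_const[OF open_S]] by simp
  have "(\<Sum>j\<in>UNIV. \<Sum>l\<in>UNIV. ricci G x $ j $ l * ?V j x * ?V l x) =
     (\<Sum>j\<in>UNIV. (\<Sum>l\<in>UNIV. ricci G x $ j $ l * ?V l x) * ?V j x)"
    by (simp add: sum_distrib_left sum_distrib_right mult_ac)
  also have "\<dots> = (\<Sum>j\<in>UNIV. (\<Sum>k\<in>UNIV. partial k (?T k j) x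
       + (\<Sum>l\<in>UNIV. ?\<Gamma> k k l * ?T l j x) - (\<Sum>l\<in>UNIV. ?\<Gamma> l k j * ?T k l x)) * ?V j x)"
    using ricci_identity[of ?V, OF V x] by (simp add: dharm)
  also have "\<dots> = (\<Sum>k\<in>UNIV. \<Sum>j\<in>UNIV. (partial k (?T k j) x
       + (\<Sum>l\<in>UNIV. ?\<Gamma> k k l * ?T l j x) - (\<Sum>l\<in>UNIV. ?\<Gamma> l k j * ?T k l x)) * ?V j x)"
    unfolding sum_distrib_right[of _ UNIV "?V _ x"] by (rule sum.swap)
  also have "\<dots> = (\<Sum>k\<in>UNIV. - (\<Sum>l\<in>UNIV. ?T k l x * ?T l k x))"
  proof (rule sum.cong[OF refl])
    fix k
    have "(\<Sum>j\<in>UNIV. (\<Sum>l\<in>UNIV. ?\<Gamma> k k l * ?T l j x) * ?V j x) =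
         (\<Sum>l\<in>UNIV. ?\<Gamma> k k l * (\<Sum>j\<in>UNIV. ?T l j x * ?V j x))"
      unfolding sum_distrib_left sum_distrib_right by (subst sum.swap) (simp add: mult_ac)
    moreover have "(\<Sum>j\<in>UNIV. (\<Sum>l\<in>UNIV. ?\<Gamma> l k j * ?T k l x) * ?V j x) =
         (\<Sum>l\<in>UNIV. ?T k l x * (\<Sum>j\<in>UNIV. ?\<Gamma> l k j * ?V j x))"
      unfolding sum_distrib_left sum_distrib_right by (subst sum.swap) (simp add: mult_ac)
    moreover have "(\<Sum>l\<in>UNIV. ?T k l x * (\<Sum>j\<in>UNIV. ?\<Gamma> l k j * ?V j x)) =
        (\<Sum>l\<in>UNIV. ?T k l x * ?T l k x) - (\<Sum>l\<in>UNIV. ?T k l x * partial k (?V l) x)"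
      unfolding sum_subtractf[symmetric] right_diff_distrib[symmetric]
      by (intro sum.cong refl arg_cong2[where f="(*)"]) (simp add: covariant_derivative_def)
    ultimately show "(\<Sum>j\<in>UNIV. (partial k (?T k j) x
       + (\<Sum>l\<in>UNIV. ?\<Gamma> k k l * ?T l j x) - (\<Sum>l\<in>UNIV. ?\<Gamma> l k j * ?T k l x)) * ?V j x) =
       - (\<Sum>l\<in>UNIV. ?T k l x * ?T l k x)"
      by (simp add: left_diff_distrib distrib_right sum_subtractf sum.distrib dTV TV[OF x])
  qed
  finally show ?thesis by (simp add: sum_negf)
qed

text \<open>If the Ricci tensor is proportional to the Hessian, then \<open>Ric (V, V)\<close> is a multiple of
  \<open>Hess F (V, V) = 0\<close>, and Bochner's formula makes the Hessian a symmetric form of norm zero.\<close>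

lemma hessian_zero:
  assumes F: "smooth_on S F" and x: "x \<in> S"
    and const: "\<And>y. y \<in> S \<Longrightarrow> (\<Sum>i\<in>UNIV. gradient G F i y * partial i F y) = c"
    and harmonic: "\<And>y. y \<in> S \<Longrightarrow> (\<Sum>k\<in>UNIV. covariant_derivative G (gradient G F) k k y) = 0"
    and ricci: "\<And>i j. ricci G x $ i $ j = r * hessian G F i j x"
    and pos: "\<And>v. v \<noteq> 0 \<Longrightarrow> 0 < v \<bullet> (G x *v v)"
  shows "hessian G F i j x = 0"
proof -
  let ?P = "\<lambda>i j. matrix_inv (G x) $ i $ j" and ?V = "gradient G F"
  let ?T = "\<lambda>k l. covariant_derivative G (gradient G F) k l x"
  have nonneg: "0 \<le> v \<bullet> (G x *v v)" for v using pos[of v] by (cases "v = 0") auto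
  \<comment> \<open>the inverse metric at \<open>v\<close> is the metric at the raised vector \<open>y\<close>\<close>
  have psd: "0 \<le> (\<Sum>i\<in>UNIV. \<Sum>j\<in>UNIV. v i * ?P i j * v j)" for v
  proof -
    define y where "y = matrix_inv (G x) *v (\<chi> i. v i)"
    have "G x *v y = (\<chi> i. v i)"
      by (simp add: y_def matrix_vector_mul_assoc matrix_inv_cancel(1)[OF invertible[OF x]])
    then have "y \<bullet> (G x *v y) = (\<Sum>i\<in>UNIV. (\<Sum>j\<in>UNIV. ?P i j * v j) * v i)"
      by (simp add: inner_vec_def y_def matrix_vector_mult_def)
    also have "\<dots> = (\<Sum>i\<in>UNIV. \<Sum>j\<in>UNIV. v i * ?P i j * v j)"
      by (simp add: sum_distrib_left sum_distrib_right mult_ac)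
    finally show ?thesis using nonneg[of y] by simp
  qed
  have "(\<Sum>j\<in>UNIV. \<Sum>l\<in>UNIV. ricci G x $ j $ l * ?V j x * ?V l x) =
     (\<Sum>j\<in>UNIV. r * ?V j x * (\<Sum>l\<in>UNIV. hessian G F j l x * ?V l x))"
    by (simp add: ricci sum_distrib_left mult_ac)
  then have "(\<Sum>k\<in>UNIV. \<Sum>l\<in>UNIV. ?T k l * ?T l k) = 0"
    using bochner_constant_length[OF F x const harmonic] by (simp add: hessian_gradient_zero[OF F x const])
  from psd_trace_square_zero[OF inverse_symmetric[OF x] psd hessian_symmetric[OF F x]
      covariant_gradient_raise[OF F x] this]
  have "(\<Sum>l\<in>UNIV. ?P m l * ?T k l) = 0" for m k .
  then have "?T k l = 0" for k l
    using lower_raise[OF x, of l "\<lambda>l. ?T k l"] by simp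
  then show ?thesis
    using lower_covariant_gradient[OF F x, of j i] by simp
qed

end

section \<open>Block matrices and functions of one factor\<close>

lemma sum_UNIV_Plus:
  "(\<Sum>s\<in>(UNIV :: ('n::finite + 'm::finite) set). \<phi> s) = (\<Sum>i\<in>UNIV. \<phi> (Inl i)) + (\<Sum>a\<in>UNIV. \<phi> (Inr a))"
  using sum.Plus[of "UNIV::'n set" "UNIV::'m set" \<phi>] by simp

lemma sum_if: "(\<Sum>i\<in>A. if P then f i else 0) = (if P then sum f A else 0)"
  by simp

lemma vfst_nth [simp]: "vfst z $ i = z $ Inl i" by (simp add: vfst_def)
lemma vsnd_nth [simp]: "vsnd z $ i = z $ Inr i" by (simp add: vsnd_def)

lemma vfst_vpair [simp]: "vfst (vpair x y) = x" by (simp add: vec_eq_iff vpair_def)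
lemma vsnd_vpair [simp]: "vsnd (vpair x y) = y" by (simp add: vec_eq_iff vpair_def)

lemma bounded_linear_vfst: "bounded_linear (vfst :: real ^ ('n::finite + 'm::finite) \<Rightarrow> real ^ 'n)"
  by (intro linear_conv_bounded_linear[THEN iffD1] linearI) (simp_all add: vec_eq_iff)

lemma bounded_linear_vsnd: "bounded_linear (vsnd :: real ^ ('n::finite + 'm::finite) \<Rightarrow> real ^ 'm)"
  by (intro linear_conv_bounded_linear[THEN iffD1] linearI) (simp_all add: vec_eq_iff)

lemma partial_linear_preimage:
  assumes "bounded_linear L" "\<phi> differentiable (at (L z))"
  shows "partial s (\<lambda>z. \<phi> (L z)) z = frechet_derivative \<phi> (at (L z)) (L (axis s 1))"
  using partial_has_derivative[OF has_derivative_compose[OF bounded_linear_imp_has_derivative[OF assms(1)]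
     differentiable_has_derivative[OF assms(2)]]] by simp

lemma partial_vfst:
  fixes z :: "real ^ ('n::finite + 'm::finite)"
  assumes "\<phi> differentiable (at (vfst z))"
  shows "partial (Inl i) (\<lambda>z. \<phi> (vfst z)) z = partial i \<phi> (vfst z)"
    and "partial (Inr a) (\<lambda>z. \<phi> (vfst z)) z = 0"
proof -
  have "vfst (axis (Inl i) 1 :: real ^ ('n + 'm)) = axis i 1" "vfst (axis (Inr a) 1 :: real ^ ('n + 'm)) = 0"
    by (auto simp: vec_eq_iff axis_def)
  then show "partial (Inl i) (\<lambda>z. \<phi> (vfst z)) z = partial i \<phi> (vfst z)"
    "partial (Inr a) (\<lambda>z. \<phi> (vfst z)) z = 0"
    unfolding partial_linear_preimage[of vfst, OF bounded_linear_vfst assms]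
    by (simp_all add: partial_def linear_0[OF linear_frechet_derivative[OF assms]])
qed

lemma partial_vsnd:
  fixes z :: "real ^ ('n::finite + 'm::finite)"
  assumes "\<phi> differentiable (at (vsnd z))"
  shows "partial (Inr a) (\<lambda>z. \<phi> (vsnd z)) z = partial a \<phi> (vsnd z)"
    and "partial (Inl i) (\<lambda>z. \<phi> (vsnd z)) z = 0"
proof -
  have "vsnd (axis (Inr a) 1 :: real ^ ('n + 'm)) = axis a 1" "vsnd (axis (Inl i) 1 :: real ^ ('n + 'm)) = 0"
    by (auto simp: vec_eq_iff axis_def)
  then show "partial (Inr a) (\<lambda>z. \<phi> (vsnd z)) z = partial a \<phi> (vsnd z)"
    "partial (Inl i) (\<lambda>z. \<phi> (vsnd z)) z = 0"
    unfolding partial_linear_preimage[of vsnd, OF bounded_linear_vsnd assms]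
    by (simp_all add: partial_def linear_0[OF linear_frechet_derivative[OF assms]])
qed

lemma differentiable_vfst:
  "\<phi> differentiable (at (vfst z)) \<Longrightarrow> (\<lambda>z. \<phi> (vfst z)) differentiable (at z)"
  using differentiable_chain_at[OF bounded_linear_imp_differentiable[OF bounded_linear_vfst]] by (simp add: o_def)

lemma differentiable_vsnd:
  "\<phi> differentiable (at (vsnd z)) \<Longrightarrow> (\<lambda>z. \<phi> (vsnd z)) differentiable (at z)"
  using differentiable_chain_at[OF bounded_linear_imp_differentiable[OF bounded_linear_vsnd]] by (simp add: o_def)

definition block_diagonal :: "real ^ 'n ^ 'n \<Rightarrow> real ^ 'm ^ 'm \<Rightarrow> real ^ ('n::finite + 'm::finite) ^ ('n + 'm)" where
  "block_diagonal A B = (\<chi> s t. case (s, t) of (Inl i, Inl j) \<Rightarrow> A $ i $ j | (Inr i, Inr j) \<Rightarrow> B $ i $ j | _ \<Rightarrow> 0)"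

lemma block_diagonal_nth [simp]:
  "block_diagonal A B $ Inl i $ Inl j = A $ i $ j"
  "block_diagonal A B $ Inr a $ Inr b = B $ a $ b"
  "block_diagonal A B $ Inl i $ Inr b = 0"
  "block_diagonal A B $ Inr a $ Inl j = 0"
  by (simp_all add: block_diagonal_def)

lemma block_diagonal_mult:
  "block_diagonal A B ** block_diagonal C D = block_diagonal (A ** C) (B ** D)"
  unfolding vec_eq_iff
proof (intro allI)
  fix s t
  show "(block_diagonal A B ** block_diagonal C D) $ s $ t = block_diagonal (A ** C) (B ** D) $ s $ t"
    by (cases s; cases t) (simp_all add: matrix_matrix_mult_def sum_UNIV_Plus)
qed

lemma block_diagonal_one: "block_diagonal (mat 1) (mat 1) = mat 1"
  unfolding vec_eq_iff
proof (intro allI)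
  fix s t :: "'a + 'b"
  show "block_diagonal (mat 1 :: real ^ 'a ^ 'a) (mat 1 :: real ^ 'b ^ 'b) $ s $ t = mat 1 $ s $ t"
    by (cases s; cases t) (simp_all add: mat_def)
qed

section \<open>Ricci curvature of a warped product\<close>

text \<open>The warped metric in one product chart, for a warping function given in coordinates.\<close>

definition warped :: "(real ^ 'n \<Rightarrow> real ^ 'n ^ 'n) \<Rightarrow> (real ^ 'n \<Rightarrow> real) \<Rightarrow> (real ^ 'm \<Rightarrow> real ^ 'm ^ 'm)
    \<Rightarrow> real ^ ('n::finite + 'm::finite) \<Rightarrow> real ^ ('n + 'm) ^ ('n + 'm)" where
  "warped g F h z = block_diagonal (g (vfst z)) ((F (vfst z))\<^sup>2 *\<^sub>R h (vsnd z))"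

locale warped_patch = base: metric_patch S g + fiber: metric_patch T h
  for S :: "(real ^ 'n::finite) set" and g and T :: "(real ^ 'm::finite) set" and h +
  fixes F :: "real ^ 'n \<Rightarrow> real"
  assumes F_smooth: "smooth_on S F" and F_nonzero: "x \<in> S \<Longrightarrow> F x \<noteq> 0"
begin

definition W :: "(real ^ ('n + 'm)) set" where "W = {z. vfst z \<in> S \<and> vsnd z \<in> T}"

abbreviation G :: "real ^ ('n + 'm) \<Rightarrow> real ^ ('n + 'm) ^ ('n + 'm)" where "G \<equiv> warped g F h"

lemma open_W: "open W"
proof -
  have "W = vfst -` S \<inter> vsnd -` T" by (auto simp: W_def)
  then show ?thesis
    by (auto intro!: open_vimage base.open_S fiber.open_S linear_continuous_on bounded_linear_vfst bounded_linear_vsnd)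
qed

lemma smooth_vfst: "smooth_on S \<phi> \<Longrightarrow> smooth_on W (\<lambda>z. \<phi> (vfst z))"
  by (rule smooth_on_linear_preimage[OF open_W bounded_linear_vfst]) (auto simp: W_def)

lemma smooth_vsnd: "smooth_on T \<phi> \<Longrightarrow> smooth_on W (\<lambda>z. \<phi> (vsnd z))"
  by (rule smooth_on_linear_preimage[OF open_W bounded_linear_vsnd]) (auto simp: W_def)

lemma warped_inverse:
  assumes "z \<in> W"
  shows "invertible (G z)"
    "matrix_inv (G z) = block_diagonal (matrix_inv (g (vfst z))) ((1 / (F (vfst z))\<^sup>2) *\<^sub>R matrix_inv (h (vsnd z)))"
proof -
  let ?B = "block_diagonal (matrix_inv (g (vfst z))) ((1 / (F (vfst z))\<^sup>2) *\<^sub>R matrix_inv (h (vsnd z)))"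
  have z: "vfst z \<in> S" "vsnd z \<in> T" using assms by (auto simp: W_def)
  have "G z ** ?B = mat 1" "?B ** G z = mat 1"
    unfolding warped_def block_diagonal_mult
    by (simp_all add: matrix_inv_cancel base.invertible fiber.invertible z F_nonzero
         matrix_scalar_ac scalar_matrix_assoc[symmetric] block_diagonal_one)
  from matrix_inv_eqI[OF this] show "invertible (G z)" "matrix_inv (G z) = ?B" by auto
qed


lemma warped_nth:
  "G z $ Inl i $ Inl j = g (vfst z) $ i $ j"
  "G z $ Inr a $ Inr b = (F (vfst z))\<^sup>2 * h (vsnd z) $ a $ b"
  "G z $ Inl i $ Inr b = 0" "G z $ Inr a $ Inl j = 0"
  by (simp_all add: warped_def)

sublocale total: metric_patch W G
proof
  show "open W" by (rule open_W)
  show "smooth_on W (\<lambda>z. G z $ s $ t)" for s t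
    by (cases s; cases t)
       (auto simp: warped_nth power2_eq_square intro!: smooth_on_mult smooth_on_const open_W base.open_S fiber.open_S
          smooth_vfst smooth_vsnd F_smooth base.component_smooth fiber.component_smooth)
  show "G z $ s $ t = G z $ t $ s" if "z \<in> W" for z s t
    using that base.sym fiber.sym by (cases s; cases t) (auto simp: warped_nth W_def)
  show "invertible (G z)" if "z \<in> W" for z
    by (rule warped_inverse(1)[OF that])
qed

lemma partial_warped:
  assumes "z \<in> W"
  shows "partial (Inl k) (\<lambda>z. G z $ Inl i $ Inl j) z = partial k (\<lambda>x. g x $ i $ j) (vfst z)"
    and "partial (Inr c) (\<lambda>z. G z $ Inl i $ Inl j) z = 0"
    and "partial (Inl k) (\<lambda>z. G z $ Inr a $ Inr b) z = 2 * F (vfst z) * partial k F (vfst z) * h (vsnd z) $ a $ b"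
    and "partial (Inr c) (\<lambda>z. G z $ Inr a $ Inr b) z = (F (vfst z))\<^sup>2 * partial c (\<lambda>y. h y $ a $ b) (vsnd z)"
    and "partial s (\<lambda>z. G z $ Inl i $ Inr b) z = 0" "partial s (\<lambda>z. G z $ Inr a $ Inl j) z = 0"
proof -
  have z: "vfst z \<in> S" "vsnd z \<in> T" using assms by (auto simp: W_def)
  note diff = base.differentiable_facts(1)[OF z(1)] fiber.differentiable_facts(1)[OF z(2)]
    smooth_on_differentiable[OF F_smooth z(1)]
  note diff' = diff differentiable_vfst[OF diff(1)] differentiable_vsnd[OF diff(2)] differentiable_vfst[OF diff(3)]
  show "partial (Inl k) (\<lambda>z. G z $ Inl i $ Inl j) z = partial k (\<lambda>x. g x $ i $ j) (vfst z)"
    "partial (Inr c) (\<lambda>z. G z $ Inl i $ Inl j) z = 0"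
    using partial_vfst[OF diff(1)] by (simp_all add: warped_nth)
  show "partial (Inl k) (\<lambda>z. G z $ Inr a $ Inr b) z = 2 * F (vfst z) * partial k F (vfst z) * h (vsnd z) $ a $ b"
    using partial_vsnd(2)[OF diff(2)] partial_vfst(1)[OF diff(3)]
    by (simp add: warped_nth power2_eq_square partial_mult diff')
  show "partial (Inr c) (\<lambda>z. G z $ Inr a $ Inr b) z = (F (vfst z))\<^sup>2 * partial c (\<lambda>y. h y $ a $ b) (vsnd z)"
    using partial_vsnd(1)[OF diff(2)] partial_vfst(2)[OF diff(3)]
    by (simp add: warped_nth power2_eq_square partial_mult diff')
  show "partial s (\<lambda>z. G z $ Inl i $ Inr b) z = 0" "partial s (\<lambda>z. G z $ Inr a $ Inl j) z = 0"
    by (simp_all add: warped_nth)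
qed

text \<open>Latin indices \<open>i, j, k\<close> belong to the base and \<open>a, b, c\<close> to the fiber. Apart from the symbols of
  the two factors only those with exactly two fiber indices survive: the fibers are umbilical with
  second fundamental form \<open>- F V h\<close>, where \<open>V\<close> is the gradient of \<open>F\<close>, and differentiating a fiber
  coordinate field along the base multiplies it by the derivative of \<open>log F\<close>.\<close>

lemma christoffel_warped:
  assumes "z \<in> W"
  shows "christoffel G (Inl k) (Inl i) (Inl j) z = christoffel g k i j (vfst z)"
    and "christoffel G (Inl k) (Inl i) (Inr b) z = 0"
    and "christoffel G (Inl k) (Inr a) (Inl j) z = 0"
    and "christoffel G (Inl k) (Inr a) (Inr b) z = - (F (vfst z) * gradient g F k (vfst z)) * h (vsnd z) $ a $ b"
    and "christoffel G (Inr c) (Inl i) (Inl j) z = 0"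
    and "christoffel G (Inr c) (Inl i) (Inr b) z = (if c = b then partial i F (vfst z) / F (vfst z) else 0)"
    and "christoffel G (Inr c) (Inr a) (Inl j) z = (if c = a then partial j F (vfst z) / F (vfst z) else 0)"
    and "christoffel G (Inr c) (Inr a) (Inr b) z = christoffel h c a b (vsnd z)"
proof -
  have z: "vfst z \<in> S" "vsnd z \<in> T" using assms by (auto simp: W_def)
  note nz = F_nonzero[OF z(1)]
  note calc = christoffel_def sum_UNIV_Plus warped_inverse(2)[OF assms] partial_warped[OF assms]
  show "christoffel G (Inl k) (Inl i) (Inl j) z = christoffel g k i j (vfst z)"
    "christoffel G (Inl k) (Inl i) (Inr b) z = 0"
    "christoffel G (Inl k) (Inr a) (Inl j) z = 0"
    "christoffel G (Inr c) (Inl i) (Inl j) z = 0"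
    by (simp_all add: calc)
  show "christoffel G (Inl k) (Inr a) (Inr b) z = - (F (vfst z) * gradient g F k (vfst z)) * h (vsnd z) $ a $ b"
    by (simp add: calc gradient_def sum_distrib_left sum_distrib_right sum_negf sum_divide_distrib mult_ac)
  show "christoffel G (Inr c) (Inr a) (Inr b) z = christoffel h c a b (vsnd z)"
    using nz by (simp add: calc left_diff_distrib[symmetric] distrib_left[symmetric] right_diff_distrib[symmetric])
  have "(\<Sum>d\<in>UNIV. matrix_inv (h (vsnd z)) $ c $ d * h (vsnd z) $ b $ d) = (if c = b then 1 else 0)" for b
    using fiber.inverse_left[OF z(2), of c b] by (simp add: fiber.sym[OF z(2), of b])
  then have "(\<Sum>d\<in>UNIV. t * (matrix_inv (h (vsnd z)) $ c $ d * h (vsnd z) $ b $ d)) = (if c = b then t else 0)" for b t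
    by (simp add: sum_distrib_left[symmetric])
  from this[of "partial _ F (vfst z) / F (vfst z)"]
  show il: "christoffel G (Inr c) (Inl i) (Inr b) z = (if c = b then partial i F (vfst z) / F (vfst z) else 0)" for i b
    using nz by (simp add: calc sum_divide_distrib power2_eq_square mult_ac)
  show "christoffel G (Inr c) (Inr a) (Inl j) z = (if c = a then partial j F (vfst z) / F (vfst z) else 0)"
    using il total.christoffel_symmetric[OF assms] by simp
qed

lemma partial_christoffel_warped:
  assumes "z \<in> W"
  shows "partial (Inl m) (christoffel G (Inl k) (Inl i) (Inl j)) z = partial m (christoffel g k i j) (vfst z)"
    and "partial s (christoffel G (Inl k) (Inl i) (Inr b)) z = 0"
    and "partial s (christoffel G (Inr c) (Inl i) (Inl j)) z = 0"
    and "partial (Inl m) (christoffel G (Inl k) (Inr a) (Inr b)) z =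
      - (F (vfst z) * partial m (gradient g F k) (vfst z) + partial m F (vfst z) * gradient g F k (vfst z)) * h (vsnd z) $ a $ b"
    and "partial (Inl m) (christoffel G (Inr c) (Inr c) (Inl j)) z =
      partial m (partial j F) (vfst z) / F (vfst z) - partial m F (vfst z) * partial j F (vfst z) / (F (vfst z))\<^sup>2"
    and "partial (Inr d) (christoffel G (Inr c) (Inr a) (Inr b)) z = partial d (christoffel h c a b) (vsnd z)"
proof -
  have z: "vfst z \<in> S" "vsnd z \<in> T" using assms by (auto simp: W_def)
  note nz = F_nonzero[OF z(1)]
  have cong: "partial s (christoffel G p q r) z = partial s \<phi> z"
    if "\<And>y. y \<in> W \<Longrightarrow> christoffel G p q r y = \<phi> y" for s p q r \<phi>
    by (rule partial_cong[OF open_W assms that total.christoffel_smooth])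
  note diff = base.differentiable_facts(2)[OF z(1)] fiber.differentiable_facts[OF z(2)]
    smooth_on_differentiable[OF F_smooth z(1)]
    smooth_on_differentiable[OF smooth_on_partial[OF F_smooth] z(1)]
    smooth_on_differentiable[OF base.gradient_smooth[OF F_smooth] z(1)]
  show "partial (Inl m) (christoffel G (Inl k) (Inl i) (Inl j)) z = partial m (christoffel g k i j) (vfst z)"
    by (subst cong, rule christoffel_warped(1), assumption, rule partial_vfst(1)[OF diff(1)])
  show "partial s (christoffel G (Inl k) (Inl i) (Inr b)) z = 0"
    by (subst cong, rule christoffel_warped(2), assumption, simp)
  show "partial s (christoffel G (Inr c) (Inl i) (Inl j)) z = 0"
    by (subst cong, rule christoffel_warped(5), assumption, simp)
  show "partial (Inr d) (christoffel G (Inr c) (Inr a) (Inr b)) z = partial d (christoffel h c a b) (vsnd z)"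
    by (subst cong, rule christoffel_warped(8), assumption, rule partial_vsnd(1)[OF diff(3)])
  have base: "(\<lambda>x. - (F x * gradient g F k x)) differentiable (at (vfst z))"
    "partial m (\<lambda>x. - (F x * gradient g F k x)) (vfst z) =
     - (F (vfst z) * partial m (gradient g F k) (vfst z) + partial m F (vfst z) * gradient g F k (vfst z))"
    using partial_mult[of "\<lambda>_. -1" _ "\<lambda>x. F x * gradient g F k x" m]
    by (auto simp: diff partial_mult)
  show "partial (Inl m) (christoffel G (Inl k) (Inr a) (Inr b)) z =
      - (F (vfst z) * partial m (gradient g F k) (vfst z) + partial m F (vfst z) * gradient g F k (vfst z)) * h (vsnd z) $ a $ b"
    by (subst cong, rule christoffel_warped(4), assumption, subst partial_mult[OF differentiable_vfst[OF base(1)] differentiable_vsnd[OF diff(2)]])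
       (simp only: partial_vfst(1)[OF base(1)] partial_vsnd(2)[OF diff(2)] base(2) mult_zero_right add_0_left)
  have d: "(\<lambda>x. partial j F x / F x) differentiable (at (vfst z))"
    using diff nz by simp
  have "partial (Inl m) (christoffel G (Inr c) (Inr c) (Inl j)) z = partial (Inl m) (\<lambda>z. partial j F (vfst z) / F (vfst z)) z"
    by (rule cong) (simp add: christoffel_warped)
  also have "\<dots> = partial m (\<lambda>x. partial j F x / F x) (vfst z)"
    by (rule partial_vfst(1)[OF d])
  also have "\<dots> = partial m (partial j F) (vfst z) / F (vfst z) - partial m F (vfst z) * partial j F (vfst z) / (F (vfst z))\<^sup>2"
    using nz by (simp add: partial_divide diff field_simps power2_eq_square)
  finally show "partial (Inl m) (christoffel G (Inr c) (Inr c) (Inl j)) z =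
      partial m (partial j F) (vfst z) / F (vfst z) - partial m F (vfst z) * partial j F (vfst z) / (F (vfst z))\<^sup>2" .
qed

text \<open>The extra terms come from the fiber index \<open>a\<close> in the trace. For each of its \<open>m\<close> values these are
  \<open>- \<partial>\<^sub>j (F\<^sub>k/F)\<close>, \<open>(F\<^sub>p/F) \<Gamma>\<^sup>p\<^sub>j\<^sub>k\<close> and \<open>- F\<^sub>j F\<^sub>k / F\<^sup>2\<close>; the last one cancels the quadratic part of the
  first.\<close>

lemma ricci_warped_base:
  assumes "z \<in> W"
  shows "ricci G z $ Inl j $ Inl k = ricci g (vfst z) $ j $ k - CARD('m) / F (vfst z) * hessian g F j k (vfst z)"
proof -
  have z: "vfst z \<in> S" "vsnd z \<in> T" using assms by (auto simp: W_def)
  note nz = F_nonzero[OF z(1)]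
  show ?thesis using nz
    by (simp add: ricci_def riemann_def sum_UNIV_Plus christoffel_warped[OF assms]
       partial_christoffel_warped[OF assms] hessian_def sum.distrib sum_subtractf
       if_distrib[of "\<lambda>c. c * _"] if_distrib[of "\<lambda>c. _ * c"] cong: if_cong)
       (simp add: field_simps power2_eq_square sum_divide_distrib sum_distrib_left sum_distrib_right)
qed

text \<open>Besides \<open>Ric\<^sub>h\<close>, the trace contains \<open>- h\<close> times the divergence of \<open>F V\<close> on the base, which is
  \<open>F \<Delta>F + \<bar>\<nabla>F\<bar>\<^sup>2\<close>, the term \<open>- m \<bar>\<nabla>F\<bar>\<^sup>2 h\<close> from \<open>\<Gamma>\<^sup>a\<^sub>a\<^sub>p \<Gamma>\<^sup>p\<^sub>b\<^sub>c\<close>, and \<open>+ 2 \<bar>\<nabla>F\<bar>\<^sup>2 h\<close> from the two mixed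
  products of Christoffel symbols.\<close>

lemma ricci_warped_fiber:
  assumes "z \<in> W"
  shows "ricci G z $ Inr b $ Inr c = ricci h (vsnd z) $ b $ c - h (vsnd z) $ b $ c *
     (F (vfst z) * (\<Sum>k\<in>UNIV. covariant_derivative g (gradient g F) k k (vfst z))
       + (real CARD('m) - 1) * (\<Sum>i\<in>UNIV. gradient g F i (vfst z) * partial i F (vfst z)))"
proof -
  have z: "vfst z \<in> S" "vsnd z \<in> T" using assms by (auto simp: W_def)
  note nz = F_nonzero[OF z(1)]
  show ?thesis using nz
    by (simp add: ricci_def riemann_def sum_UNIV_Plus christoffel_warped[OF assms]
       partial_christoffel_warped[OF assms] covariant_derivative_def sum.distrib sum_subtractf sum_negf sum_if
       if_distrib[of "\<lambda>c. c * _"] if_distrib[of "\<lambda>c. _ * c"] if_distrib[of uminus] cong: if_cong)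
       (simp add: field_simps power2_eq_square sum_divide_distrib sum_distrib_left sum_distrib_right sum.distrib sum_negf sum_subtractf)
qed

end

section \<open>Ricci-flat warped products over a scalar-flat base\<close>

context warped_patch
begin

text \<open>The two blocks of the equation \<open>Ric = 0\<close> on the warped product make \<open>F\<close> harmonic with gradient of
  constant length.\<close>

lemma ricci_flat_base:
  assumes pos: "\<And>x v. x \<in> S \<Longrightarrow> v \<noteq> 0 \<Longrightarrow> 0 < v \<bullet> (g x *v v)"
    and scalar: "\<And>x. x \<in> S \<Longrightarrow> scalar g x = 0"
    and flat: "\<And>z. z \<in> W \<Longrightarrow> ricci G z = 0"
    and dim: "CARD('m) \<ge> 2" and T: "T \<noteq> {}" and x: "x \<in> S"
  shows "ricci g x = 0"
proof -
  obtain y where y: "y \<in> T" using T by blast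
  have W: "vpair x y \<in> W" if "x \<in> S" for x using that y by (simp add: W_def)
  have ricci: "ricci g x $ j $ k = CARD('m) / F x * hessian g F j k x" if "x \<in> S" for x j k
    using ricci_warped_base[OF W[OF that], of j k] flat[OF W[OF that]] by simp
  have harmonic: "(\<Sum>k\<in>UNIV. covariant_derivative g (gradient g F) k k x) = 0" if "x \<in> S" for x
  proof -
    have "0 = (\<Sum>j\<in>UNIV. \<Sum>k\<in>UNIV. matrix_inv (g x) $ j $ k * (CARD('m) / F x * hessian g F k j x))"
      using scalar[OF that] by (simp add: scalar_def ricci that
          base.hessian_symmetric[OF F_smooth that, of _ "_ :: 'n"] cong: sum.cong)
    also have "\<dots> = CARD('m) / F x * (\<Sum>k\<in>UNIV. covariant_derivative g (gradient g F) k k x)"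
      by (simp add: base.covariant_gradient_raise[OF F_smooth that] sum_distrib_left mult_ac)
    finally show ?thesis using F_nonzero[OF that] by simp
  qed
  obtain b c where bc: "h y $ b $ c \<noteq> 0"
  proof -
    have "\<exists>b c. h y $ b $ c \<noteq> 0"
    proof (rule ccontr)
      assume "\<not> ?thesis"
      then show False using fiber.inverse_left[OF y, of undefined undefined] by simp
    qed
    then show ?thesis using that by blast
  qed
  \<comment> \<open>\<open>y\<close> stays fixed while \<open>x\<close> varies over the chart; dividing needs a fiber of dimension at least two\<close>
  have const: "(\<Sum>i\<in>UNIV. gradient g F i x * partial i F x) = ricci h y $ b $ c / (h y $ b $ c * (real CARD('m) - 1))"
    if "x \<in> S" for x
    using ricci_warped_fiber[OF W[OF that], of b c] flat[OF W[OF that]] harmonic[OF that] bc dim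
    by (simp add: field_simps)
  have "hessian g F i j x = 0" for i j
    by (rule base.hessian_zero[OF F_smooth x const harmonic ricci[OF x] pos[OF x]])
  then show ?thesis by (simp add: vec_eq_iff ricci[OF x])
qed

end

section \<open>From charts to manifolds\<close>

lemma param_in_cdom: "x \<in> cimg M a \<Longrightarrow> param M a x \<in> cdom M a"
  unfolding cimg_def param_def by (rule inv_into_into)

lemma symmetric_nth: "transpose A = A \<Longrightarrow> A $ i $ j = A $ j $ i"
  by (metis transpose_def vec_lambda_beta)

lemma riemannian_metric_patch:
  assumes "smooth_manifold M" "riemannian_metric M g" "a \<in> charts M"
  shows "metric_patch (cimg M a) (g a)"
proof
  have g: "smooth_symmetric_2_tensor M g" using assms(2) by (simp add: riemannian_metric_def)
  show "open (cimg M a)" using assms by (simp add: smooth_manifold_def)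
  then show "smooth_on (cimg M a) (\<lambda>x. g a x $ i $ j)" for i j
    using g assms(3) by (intro smooth_on_vec_nth) (auto simp: smooth_symmetric_2_tensor_def)
  show "g a x $ i $ j = g a x $ j $ i" if "x \<in> cimg M a" for x i j
    using g assms(3) that by (intro symmetric_nth) (auto simp: smooth_symmetric_2_tensor_def)
  show "invertible (g a x)" if x: "x \<in> cimg M a" for x
  proof -
    have "v = 0" if "g a x *v v = 0" for v
      using assms(2,3) x that unfolding riemannian_metric_def by (metis inner_zero_right less_irrefl)
    then show ?thesis
      by (simp add: invertible_left_inverse matrix_left_invertible_ker)
  qed
qed

lemma semi_riemannian_metric_patch:
  assumes "smooth_manifold N" "semi_riemannian_metric N h" "b \<in> charts N"
  shows "metric_patch (cimg N b) (h b)"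
proof
  have h: "smooth_symmetric_2_tensor N h" using assms(2) by (simp add: semi_riemannian_metric_def)
  show "open (cimg N b)" using assms by (simp add: smooth_manifold_def)
  then show "smooth_on (cimg N b) (\<lambda>x. h b x $ i $ j)" for i j
    using h assms(3) by (intro smooth_on_vec_nth) (auto simp: smooth_symmetric_2_tensor_def)
  show "h b x $ i $ j = h b x $ j $ i" if "x \<in> cimg N b" for x i j
    using h assms(3) that by (intro symmetric_nth) (auto simp: smooth_symmetric_2_tensor_def)
  show "invertible (h b x)" if x: "x \<in> cimg N b" for x
    using assms(2,3) x by (simp add: semi_riemannian_metric_def)
qed

lemma warped_metric_eq: "warped_metric M g f h (a, b) = warped (g a) (f \<circ> param M a) (h b)"
proof (intro ext)
  fix z
  show "warped_metric M g f h (a, b) z = warped (g a) (f \<circ> param M a) (h b) z"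
    unfolding vec_eq_iff
  proof (intro allI)
    fix s t
    show "warped_metric M g f h (a, b) z $ s $ t = warped (g a) (f \<circ> param M a) (h b) z $ s $ t"
      by (cases s; cases t) (simp_all add: warped_metric_def warped_def)
  qed
qed

lemma cimg_product:
  assumes "vfst z \<in> cimg M a" "vsnd z \<in> cimg N b"
  shows "z \<in> cimg (product_manifold M N) (a, b)"
proof -
  obtain p q where "p \<in> cdom M a" "q \<in> cdom N b" "vfst z = cmap M a p" "vsnd z = cmap N b q"
    using assms by (auto simp: cimg_def)
  moreover have "z = vpair (vfst z) (vsnd z)"
    by (auto simp: vec_eq_iff vpair_def split: sum.split)
  ultimately show ?thesis
    by (force simp: cimg_def product_manifold_def)
qed

lemma nonempty_chart:
  assumes "smooth_manifold M"
  obtains a where "a \<in> charts M" "cimg M a \<noteq> {}"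
proof -
  have "topspace (pts M) \<noteq> {}" using assms unfolding smooth_manifold_def by blast
  then obtain p where "p \<in> topspace (pts M)" by blast
  then obtain a where "a \<in> charts M" "p \<in> cdom M a" using assms by (auto simp: smooth_manifold_def)
  then show ?thesis using that by (auto simp: cimg_def)
qed

theorem theorem3:
  fixes M :: "('p, 'i, 'n::finite) manifold"
    and g :: "'i \<Rightarrow> real ^ 'n \<Rightarrow> real ^ 'n ^ 'n"
    and N :: "('q, 'j, 'm::finite) manifold"
    and h :: "'j \<Rightarrow> real ^ 'm \<Rightarrow> real ^ 'm ^ 'm"
    and f :: "'p \<Rightarrow> real"
    and R lam :: real
  assumes "CARD('n) \<ge> 3" and "CARD('m) \<ge> 2"
    and "smooth_manifold M" and "\<not> compact_space (pts M)" and "riemannian_metric M g"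
    and "constant_scalar_curvature M g R"
    and "smooth_manifold N" and "semi_riemannian_metric N h"
    and "smooth_function M f" and "\<And>p. p \<in> topspace (pts M) \<Longrightarrow> f p > 0"
    and "lam = R / (real CARD('n) - 1)"
    and "einstein (product_manifold M N) (warped_metric M g f h) lam"
  shows "ricci_flat M g \<longleftrightarrow> R = 0"
proof
  assume flat: "ricci_flat M g"
  obtain a x where "a \<in> charts M" "x \<in> cimg M a"
    using nonempty_chart[OF assms(3)] by blast
  then show "R = 0"
    using flat assms(6) by (force simp: ricci_flat_def constant_scalar_curvature_def scalar_def)
next
  assume R: "R = 0"
  obtain b where b: "b \<in> charts N" "cimg N b \<noteq> {}"
    using nonempty_chart[OF assms(7)] by blast
  have "ricci (g a) x = 0" if a: "a \<in> charts M" and x: "x \<in> cimg M a" for a x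
  proof -
    interpret warped_patch "cimg M a" "g a" "cimg N b" "h b" "f \<circ> param M a"
    proof (intro warped_patch.intro warped_patch_axioms.intro)
      show "metric_patch (cimg M a) (g a)" by (rule riemannian_metric_patch[OF assms(3,5) a])
      show "metric_patch (cimg N b) (h b)" by (rule semi_riemannian_metric_patch[OF assms(7,8) b(1)])
      show "smooth_on (cimg M a) (f \<circ> param M a)" using assms(9) a by (simp add: smooth_function_def)
      show "(f \<circ> param M a) x \<noteq> 0" if "x \<in> cimg M a" for x
      proof -
        have "param M a x \<in> topspace (pts M)"
          using param_in_cdom[OF that] assms(3) a by (auto simp: smooth_manifold_def)
        from assms(10)[OF this] show ?thesis by simp
      qed
    qed
    show ?thesis
    proof (rule ricci_flat_base[OF _ _ _ assms(2) b(2) x])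
      show "0 < v \<bullet> (g a y *v v)" if "y \<in> cimg M a" "v \<noteq> 0" for y v
        using assms(5) a that by (simp add: riemannian_metric_def)
      show "scalar (g a) y = 0" if "y \<in> cimg M a" for y
        using assms(6) a that R by (simp add: constant_scalar_curvature_def)
      show "ricci G z = 0" if "z \<in> W" for z
      proof -
        have "z \<in> cimg (product_manifold M N) (a, b)"
          using that by (auto simp: W_def intro: cimg_product)
        moreover have "(a, b) \<in> charts (product_manifold M N)"
          using a b by (simp add: product_manifold_def)
        ultimately show ?thesis
          using assms(11,12) R by (auto simp: einstein_def warped_metric_eq)
      qed
    qed
  qed
  then show "ricci_flat M g" by (simp add: ricci_flat_def)
qed

end
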